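(* Let $n$ be a positive integer, let $E \subseteq \mathbb{T}$ be a union of at most $n$ arcs, and put $c_k = \widehat{E}(k)$ for $0 \le k \le n$. Let $m_0, \dots, m_n$ be the Taylor coefficients at $0$, up to order $n$, of the function $z \mapsto \phi\left(\frac{c_0}{2} + \sum_{k=1}^n c_k z^k\right)$, and let $M$ be the $(n+1)\times(n+1)$ lower-triangular Toeplitz matrix with first column $(m_0, \dots, m_n)$, regarded as a linear operator on the space $P$. Then: (i) $M = T_{b_E}$, and for every nonzero $q \in P$ satisfying $\|Mq\| = \|q\|$ one has $b_E = \frac{Mq}{q}$; (ii) if $q$ is chosen to have minimal degree among the nonzero elements of $P$ satisfying $\|Mq\| = \|q\|$, then the polynomials $Mq$ and $q$ have no nontrivial common factors; in this case the degree of $q$ is the order of $b_E$, and the endpoints of the arcs of $E$, which are the solutions of $b_E(z) = 1$ and $b_E(z) = -1$, are the roots of the polynomials $Mq - q$ and $Mq + q$.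
   Context: $\mathbb{T} = \{z \in \mathbb{C} : |z| = 1\}$, $\mathbb{D} = \{z \in \mathbb{C} : |z|<1\}$. For $E \subseteq \mathbb{T}$ and an integer $k$, $\widehat{E}(k) = \frac{1}{2\pi}\int_0^{2\pi} \chi_E(e^{it}) e^{-ikt}\,dt$, where $\chi_E$ is the characteristic function of $E$. An arc is by definition a closed, connected, proper and nonempty subset of $\mathbb{T}$; $\mathbb{T}$ along with the empty set is declared to be a "union of $0$ arcs". The arcs of $E$ are the connected components of $E$ when $E \ne \mathbb{T}, \emptyset$; when $E$ is $\mathbb{T}$ or $\emptyset$ there are no arcs and no endpoints. The function $\phi$ is $\phi(z) = \frac{\exp(2\pi i(z-1/4)) - 1}{\exp(2\pi i(z-1/4)) + 1}$. The function $h_E$ is $h_E(z) = \frac12\widehat{E}(0) + \sum_{k=1}^\infty \widehat{E}(k) z^k$ for $z \in \mathbb{D}$, and $b_E = \phi\circ h_E$ on $\mathbb{D}$; $b_E$ extends to a Blaschke product, denoted by the same symbol. A Blaschke product of order $m \ge 0$ is a function $b(z) = \lambda\prod_{j=1}^m \frac{z-a_j}{1-\overline{a_j}z}$ with $\lambda \in \mathbb{T}$ and $a_1, \dots, a_m \in \mathbb{D}$ (the empty product is $1$). $P$ is the space of complex polynomials in $z$ of degree at most $n$, viewed as a subspace of $L^2(\mathbb{T})$ with the norm $\|p\|^2 = \frac{1}{2\pi}\int_0^{2\pi}|p(e^{it})|^2\,dt$, for which $1, z, \dots, z^n$ is an orthonormal basis; $(n+1)\times(n+1)$ matrices are identified with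 linear operators on $P$ via this ordered basis. For bounded $f : \mathbb{T} \to \mathbb{C}$, $T_f : P \to P$ is the linear map $T_f \xi = \pi(f\xi)$, where $\pi : L^2(\mathbb{T}) \to P$ is the orthogonal projection.
   Formalization: deg q = order of b_E is claimed only for c_0 ≠ 1/2 (it fails for a half circle, where q is constant); in general max(deg q, deg Mq) is the order. Endpoints are those of arcs with more than one point, since for E = {1} b_E is constant and b_E = ±1 has no solution. *)

theory Defs
  imports
    "HOL-Analysis.Analysis"
    "HOL-Computational_Algebra.Polynomial"
    "Jordan_Normal_Form.Matrix"
begin

section \<open>Arcs of the unit circle\<close>

abbreviation unit_circle :: "complex set" where
  "unit_circle \<equiv> sphere 0 1"

definition is_arc :: "complex set \<Rightarrow> bool" where
  "is_arc A \<longleftrightarrow> closed A \<and> connected A \<and> A \<subset> unit_circle \<and> A \<noteq> {}"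

text \<open>The circle and the empty set are unions of 0 arcs; for the empty set take the empty family.\<close>

definition union_of_arcs :: "nat \<Rightarrow> complex set \<Rightarrow> bool" where
  "union_of_arcs n E \<longleftrightarrow> E = unit_circle \<or>
     (\<exists>\<A>. finite \<A> \<and> card \<A> \<le> n \<and> (\<forall>A\<in>\<A>. is_arc A) \<and> E = \<Union>\<A>)"

definition arcs_of :: "complex set \<Rightarrow> complex set set" where
  "arcs_of E = (if E = unit_circle then {} else components E)"

definition endpoints :: "complex set \<Rightarrow> complex set" where
  "endpoints A = {z. \<exists>s t. s \<le> t \<and> t < s + 2 * pi \<and> A = cis ` {s..t} \<and> (z = cis s \<or> z = cis t)}"

section \<open>The function $b_E$\<close>

definition fourier_coeff :: "complex set \<Rightarrow> int \<Rightarrow> complex" where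
  "fourier_coeff E k =
     1 / (2 * pi) * integral {0..2*pi} (\<lambda>t. indicator E (cis t) * exp (- \<i> * of_int k * of_real t))"

definition phi :: "complex \<Rightarrow> complex" where
  "phi z = (exp (2 * pi * \<i> * (z - 1/4)) - 1) / (exp (2 * pi * \<i> * (z - 1/4)) + 1)"

definition h_fun :: "complex set \<Rightarrow> complex \<Rightarrow> complex" where
  "h_fun E z = 1/2 * fourier_coeff E 0 + (\<Sum>k. fourier_coeff E (int (Suc k)) * z ^ Suc k)"

text \<open>\<open>b\<close> is a Blaschke product of order \<open>m\<close>.  It is a total function on the plane: since
  division by zero gives zero, its value at each of its poles \<open>1 / cnj (a j)\<close> is 0.\<close>

definition blaschke_product :: "nat \<Rightarrow> (complex \<Rightarrow> complex) \<Rightarrow> bool" where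
  "blaschke_product m b \<longleftrightarrow>
     (\<exists>u a. norm u = 1 \<and> (\<forall>j\<in>{1..m}. norm (a j) < 1) \<and>
        b = (\<lambda>z. u * (\<Prod>j=1..m. (z - a j) / (1 - cnj (a j) * z))))"

definition blaschke_extension :: "complex set \<Rightarrow> (complex \<Rightarrow> complex) \<Rightarrow> bool" where
  "blaschke_extension E b \<longleftrightarrow>
     (\<exists>m. blaschke_product m b) \<and> (\<forall>z\<in>ball 0 1. b z = phi (h_fun E z))"

definition b_fun :: "complex set \<Rightarrow> complex \<Rightarrow> complex" where
  "b_fun E = (THE b. blaschke_extension E b)"

section \<open>Operators on the polynomials of degree at most $n$\<close>

definition polys :: "nat \<Rightarrow> complex poly set" where
  "polys n = {p. degree p \<le> n}"

text \<open>The inner product and norm of $L^2(\mathbb{T})$; only values on the circle matter.\<close>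

definition circle_inner :: "(complex \<Rightarrow> complex) \<Rightarrow> (complex \<Rightarrow> complex) \<Rightarrow> complex" where
  "circle_inner f g = 1 / (2 * pi) * integral {0..2*pi} (\<lambda>t. f (cis t) * cnj (g (cis t)))"

definition poly_norm :: "complex poly \<Rightarrow> real" where
  "poly_norm p = sqrt (1 / (2 * pi) * integral {0..2*pi} (\<lambda>t. (norm (poly p (cis t)))\<^sup>2))"

definition orth_proj :: "nat \<Rightarrow> (complex \<Rightarrow> complex) \<Rightarrow> complex poly" where
  "orth_proj n g = (THE p. p \<in> polys n \<and>
     (\<forall>r\<in>polys n. circle_inner (\<lambda>z. g z - poly p z) (poly r) = 0))"

definition toeplitz_op :: "nat \<Rightarrow> (complex \<Rightarrow> complex) \<Rightarrow> complex poly \<Rightarrow> complex poly" where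
  "toeplitz_op n f \<xi> = orth_proj n (\<lambda>z. f z * poly \<xi> z)"

definition lower_toeplitz :: "nat \<Rightarrow> (nat \<Rightarrow> complex) \<Rightarrow> complex mat" where
  "lower_toeplitz n m = Matrix.mat (n + 1) (n + 1) (\<lambda>(i, j). if j \<le> i then m (i - j) else 0)"

text \<open>The operator whose matrix in the ordered basis $1, z, \dots, z^n$ is \<open>A\<close>.\<close>

definition mat_op :: "nat \<Rightarrow> complex mat \<Rightarrow> complex poly \<Rightarrow> complex poly" where
  "mat_op n A p = (\<Sum>i\<le>n. monom (\<Sum>j\<le>n. A $$ (i, j) * coeff p j) i)"

definition norm_attaining :: "nat \<Rightarrow> complex mat \<Rightarrow> complex poly \<Rightarrow> bool" where
  "norm_attaining n A q \<longleftrightarrow> q \<in> polys n \<and> q \<noteq> 0 \<and> poly_norm (mat_op n A q) = poly_norm q"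

end

theory Submission
  imports
    Defs
    "HOL-Complex_Analysis.Complex_Analysis"
    "HOL-Computational_Algebra.Fundamental_Theorem_Algebra"
    "HOL-Computational_Algebra.Field_as_Ring"
    "HOL-Computational_Algebra.Polynomial_Factorial"
begin

text \<open>
  The exponential \<open>R = exp (2 * pi * \<i> * h_E)\<close> is a rational function.  Indeed \<open>h_E\<close> is half the
  Herglotz integral of the indicator of \<open>E\<close>, and over a single arc from \<open>u\<close> to \<open>v\<close> that integral is
  elementary; its exponential is a unimodular constant times \<open>(1 - cnj v * z) / (1 - cnj u * z)\<close>.
  Hence \<open>R = Q / P\<close> where \<open>P\<close> vanishes exactly at the initial points of the arcs and \<open>Q\<close> exactly at
  their final points, and \<open>\<phi> \<circ> h_E = B / A\<close> with \<open>A = P - \<i> Q\<close> and \<open>B = - (P + \<i> Q)\<close>.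

  The pair \<open>(A, B)\<close> carries the whole theorem.  The polynomials \<open>P\<close> and \<open>Q\<close> equal their own conjugate
  reflections up to one common unimodular factor, so \<open>B\<close> is a unimodular multiple of the conjugate
  reflection of \<open>A\<close>.  The Herglotz kernel has nonnegative real part and total mass \<open>2 * pi\<close>, so
  \<open>0 \<le> Re h_E \<le> 1/2\<close>; this puts \<open>- \<i> R\<close> in the closed right half plane and keeps \<open>A\<close> free of zeros in
  the disc.  Factoring \<open>A\<close> then exhibits \<open>B / A\<close> as a Blaschke product whose order is the number of
  nondegenerate arcs (\<open>blaschke_pair_of_reflection\<close>, \<open>blaschke_pair_of_exp_quotient\<close>).
  Since \<open>B - A = -2 P\<close> and \<open>B + A = -2 \<i> Q\<close>, the solutions of \<open>b_E = 1\<close> and \<open>b_E = -1\<close> are the endpoints.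

  Truncating \<open>h_E\<close> after degree \<open>n\<close> does not change the Taylor coefficients of \<open>\<phi> \<circ> h_E\<close> up to
  degree \<open>n\<close> (\<open>taylor_congruence\<close>).  Therefore \<open>B q\<close> and \<open>A * M q\<close> agree modulo \<open>z ^ (n + 1)\<close>, which
  says that \<open>b_E q - M q\<close> is \<open>z ^ (n + 1)\<close> times a function holomorphic near the closed disc, hence
  orthogonal to the polynomials of degree at most \<open>n\<close>: this is \<open>M = T_b\<close>.  As \<open>b_E\<close> is unimodular on
  the circle, Pythagoras shows that \<open>M\<close> attains its norm at \<open>q\<close> only if that error vanishes, that is
  \<open>B q = A * M q\<close>; by coprimality \<open>q = A r\<close> and \<open>M q = B r\<close> (\<open>norm_attaining_multiples\<close>).  The choice
  of minimal degree makes \<open>r\<close> constant, so that \<open>q\<close> and \<open>M q\<close> are \<open>A\<close> and \<open>B\<close> up to one scalar.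
\<close>

section \<open>Arcs of the circle\<close>

lemma cis_eq_cis_imp_eq:
  assumes "s \<le> t" "t < s + 2 * pi" "cis s = cis t"
  shows "s = t"
proof -
  have "cis (t - s) = 1"
    using assms(3) by (metis cis_divide cis_neq_zero divide_self)
  then have "cos (t - s) = 1"
    by (metis cis.simps(1) one_complex.simps(1))
  then obtain k :: int where k: "t - s = of_int k * 2 * pi"
    by (auto simp: cos_one_2pi_int)
  have "k = 0"
  proof -
    have "of_int k * (2 * pi) < 1 * (2 * pi)" "of_int k * (2 * pi) \<ge> 0 * (2 * pi)"
      using k assms by linarith+
    then have "of_int k < (1::real)" "(0::real) \<le> of_int k"
      using pi_gt_zero by (simp_all only: mult_less_cancel_right mult_le_cancel_right)
    then show ?thesis by linarith
  qed
  then show ?thesis using k by simp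
qed

text \<open>Cutting the circle at a point outside \<open>C\<close> turns the argument into a continuous function on
  \<open>C\<close>, whose image is a compact interval strictly inside \<open>]-pi, pi[\<close>.\<close>

lemma closed_connected_eq_cis_image:
  assumes "closed C" "connected C" "C \<subset> unit_circle" "C \<noteq> {}"
  shows "\<exists>s t. s \<le> t \<and> t < s + 2 * pi \<and> C = cis ` {s..t}"
proof -
  obtain w where w: "norm w = 1" "w \<notin> C"
    using psubset_imp_ex_mem[OF assms(3)] by auto
  define f where "f z = Arg (- (z / w))" for z
  \<comment> \<open>The argument of the point opposite to the cut \<open>w\<close>, relative to which \<open>f\<close> measures angles.\<close>
  define \<alpha> where "\<alpha> = Arg (- w)"
  have nz: "norm z = 1" if "z \<in> C" for z
    using that assms(3) by auto
  have w0: "w \<noteq> 0" using w by auto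
  have off: "- (z / w) \<notin> \<real>\<^sub>\<le>\<^sub>0" if "z \<in> C" for z
  proof
    assume "- (z / w) \<in> \<real>\<^sub>\<le>\<^sub>0"
    then obtain r where r: "- (z / w) = of_real r" "r \<le> 0"
      by (rule nonpos_Reals_cases)
    have "norm (- (z / w)) = 1" using nz[OF that] w by (simp add: norm_divide)
    then have "r = -1" using r by auto
    then have "z = w" using r w0 by (simp add: field_simps)
    then show False using that w by simp
  qed
  have cont: "continuous_on C f"
    unfolding f_def using off w0 by (intro continuous_intros) auto
  have "compact C"
    using assms(1,3) by (metis bounded_sphere bounded_subset compact_eq_bounded_closed psubset_imp_subset)
  then have "connected (f ` C) \<and> compact (f ` C)"
    using cont assms(2) by (simp add: compact_continuous_image connected_continuous_image)
  then obtain a b where ab: "f ` C = {a..b}"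
    using connected_compact_interval_1 by (metis box_real(2))
  with assms(4) have "a \<le> b" by force
  have cisf: "cis (f z + \<alpha>) = z" if "z \<in> C" for z
  proof -
    have "norm (- (z / w)) = 1" using nz[OF that] w by (simp add: norm_divide)
    then have "cis (f z) = - (z / w)"
      unfolding f_def by (metis cis_Arg norm_zero sgn_eq zero_neq_one div_by_1 of_real_1)
    moreover have "cis \<alpha> = - w"
      unfolding \<alpha>_def using w by (metis cis_Arg norm_minus_cancel norm_zero sgn_eq zero_neq_one div_by_1 of_real_1)
    ultimately show ?thesis using w0 by (simp flip: cis_mult)
  qed
  have bd: "- pi < f z \<and> f z < pi" if "z \<in> C" for z
  proof -
    have "f z \<noteq> pi"
    proof
      assume "f z = pi"
      then have "- (z / w) \<in> \<real>\<^sub>\<le>\<^sub>0"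
        unfolding f_def by (metis Arg_eq_pi complex_nonpos_Reals_iff less_imp_le)
      then show False using off that by blast
    qed
    then show ?thesis using Arg_bounded[of "- (z / w)"] by (auto simp: f_def)
  qed
  have "- pi < a" "b < pi"
    using bd ab \<open>a \<le> b\<close> by (metis atLeastAtMost_iff imageE order_refl)+
  have "C = (\<lambda>z. cis (f z + \<alpha>)) ` C"
    using cisf by force
  also have "\<dots> = cis ` ((\<lambda>x. x + \<alpha>) ` (f ` C))"
    by (simp add: image_image)
  also have "\<dots> = cis ` {a + \<alpha>..b + \<alpha>}"
    unfolding ab by simp
  finally have "C = cis ` {a + \<alpha>..b + \<alpha>}" .
  moreover have "b + \<alpha> < a + \<alpha> + 2 * pi"
    using \<open>- pi < a\<close> \<open>b < pi\<close> by simp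
  ultimately show ?thesis using \<open>a \<le> b\<close> by (metis add_le_cancel_right)
qed

text \<open>Every component swallows some member of the family, and distinct components swallow
  distinct members.\<close>

lemma components_Union_card_le:
  assumes "finite \<A>" "\<And>A. A \<in> \<A> \<Longrightarrow> connected A \<and> A \<noteq> {}"
  shows "finite (components (\<Union>\<A>))" "card (components (\<Union>\<A>)) \<le> card \<A>"
proof -
  have ex: "\<exists>A\<in>\<A>. A \<subseteq> C" if C: "C \<in> components (\<Union>\<A>)" for C
  proof -
    obtain x where x: "x \<in> C" using C in_components_nonempty by blast
    then obtain A where A: "A \<in> \<A>" "x \<in> A" using C in_components_subset by blast
    have "A \<subseteq> C"
      by (rule components_maximal[OF C]) (use A x assms in auto)
    then show ?thesis using A by blast
  qed
  define F where "F C = (SOME A. A \<in> \<A> \<and> A \<subseteq> C)" for C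
  have F: "F C \<in> \<A>" "F C \<subseteq> C" if "C \<in> components (\<Union>\<A>)" for C
    using someI_ex[OF ex[OF that, unfolded Bex_def]] unfolding F_def by auto
  have inj: "inj_on F (components (\<Union>\<A>))"
  proof
    fix C D assume CD: "C \<in> components (\<Union>\<A>)" "D \<in> components (\<Union>\<A>)" "F C = F D"
    have "F C \<noteq> {}" using F assms CD by blast
    then have "C \<inter> D \<noteq> {}" using F CD by (metis inf.bounded_iff subset_empty)
    then show "C = D" using CD components_nonoverlap by blast
  qed
  have sub: "F ` components (\<Union>\<A>) \<subseteq> \<A>" using F by blast
  show "finite (components (\<Union>\<A>))"
    using inj sub assms(1) by (metis finite_imageD finite_subset)
  show "card (components (\<Union>\<A>)) \<le> card \<A>"
    using inj sub assms(1) by (rule card_inj_on_le)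
qed

lemma union_of_arcs_components:
  assumes "union_of_arcs n E" "E \<subseteq> unit_circle" "E \<noteq> unit_circle"
  shows "finite (components E)" "card (components E) \<le> n"
    and "\<And>C. C \<in> components E \<Longrightarrow> \<exists>s t. s \<le> t \<and> t < s + 2 * pi \<and> C = cis ` {s..t}"
proof -
  obtain \<A> where \<A>: "finite \<A>" "card \<A> \<le> n" "\<And>A. A \<in> \<A> \<Longrightarrow> is_arc A" "E = \<Union>\<A>"
    using assms(1,3) unfolding union_of_arcs_def by blast
  show "finite (components E)" "card (components E) \<le> n"
    using components_Union_card_le[of \<A>] \<A> by (auto simp: is_arc_def)
  have "closed E" using \<A> by (auto simp: is_arc_def intro!: closed_Union)
  show "\<exists>s t. s \<le> t \<and> t < s + 2 * pi \<and> C = cis ` {s..t}" if C: "C \<in> components E" for C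
  proof (rule closed_connected_eq_cis_image)
    show "closed C" using C \<open>closed E\<close> closed_components by blast
    show "connected C" "C \<noteq> {}"
      using C in_components_connected in_components_nonempty by blast+
    show "C \<subset> unit_circle"
      using in_components_subset[OF C] assms(2,3) by blast
  qed
qed

section \<open>Integration over a union of arcs\<close>

lemma has_integral_periodic_shift:
  fixes F :: "real \<Rightarrow> complex"
  assumes per: "\<And>x. F (x + p) = F x" and p: "p > 0" and int: "(F has_integral I) {a..a + p}"
  shows "(F has_integral I) {b..b + p}"
proof -
  have per': "F (x + of_int k * p) = F x" for x k
  proof (induction k rule: int_induct[where k = 0])
    case (step1 i)
    then show ?case using per[of "x + of_int i * p"] by (simp add: algebra_simps)
  next
    case (step2 i)
    then show ?case using per[of "x + of_int (i - 1) * p"] by (simp add: algebra_simps)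
  qed simp
  have shift: "(F has_integral J) {c + of_int k * p..d + of_int k * p}"
    if "(F has_integral J) {c..d}" for c d J k
  proof -
    have "((\<lambda>x. F (x + of_int (- k) * p)) has_integral J) {c - of_int (- k) * p..d - of_int (- k) * p}"
      by (rule has_integral_shift_real_ivl[OF that])
    then show ?thesis unfolding per' by simp
  qed
  \<comment> \<open>The shift by \<open>k\<close> periods that brings \<open>b\<close> into \<open>[a, a + p]\<close>.\<close>
  define k where "k = \<lceil>(a - b) / p\<rceil>"
  define b' where "b' = b + of_int k * p"
  have "a \<le> b'" "b' \<le> a + p"
  proof -
    have "(a - b) / p \<le> of_int k" "of_int k \<le> (a - b) / p + 1"
      unfolding k_def by linarith+
    then show "a \<le> b'" "b' \<le> a + p"
      using p by (auto simp: b'_def pos_divide_le_eq pos_le_divide_eq add_divide_distrib field_simps)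
  qed
  have "F integrable_on {a..a + p}" using int by blast
  then obtain I1 I2 where I: "(F has_integral I1) {a..b'}" "(F has_integral I2) {b'..a + p}"
    using \<open>a \<le> b'\<close> \<open>b' \<le> a + p\<close>
    by (meson atLeastatMost_subset_iff has_integral_integrable_integral integrable_on_subinterval order_refl)
  have "(F has_integral I1 + I2) {a..a + p}"
    using has_integral_combine[OF \<open>a \<le> b'\<close> \<open>b' \<le> a + p\<close> I] .
  then have "I = I1 + I2" using int has_integral_unique by blast
  have "(F has_integral I1) {a + p..b' + p}" using shift[OF I(1), of 1] by simp
  then have "(F has_integral I2 + I1) {b'..b' + p}"
    using has_integral_combine[OF _ _ I(2)] \<open>a \<le> b'\<close> \<open>b' \<le> a + p\<close> by simp
  then have "(F has_integral I) {b'..b' + p}" using \<open>I = I1 + I2\<close> by (simp add: add.commute)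
  from shift[OF this, of "- k"] show ?thesis by (simp add: b'_def algebra_simps)
qed

text \<open>By periodicity the period may be taken to start at \<open>s\<close>, where membership in the arc is just
  \<open>x \<le> t\<close>, except at the last point of the period.\<close>

lemma has_integral_indicator_arc:
  fixes g :: "real \<Rightarrow> complex"
  assumes g: "continuous_on UNIV g" and per: "\<And>x. g (x + 2 * pi) = g x" and st: "s \<le> t" "t < s + 2 * pi"
  shows "((\<lambda>x. indicator (cis ` {s..t}) (cis x) * g x) has_integral integral {s..t} g) {0..2 * pi}"
proof -
  have "(g has_integral integral {s..t} g) {s..t}"
    by (meson g continuous_on_subset integrable_continuous_real integrable_integral subset_UNIV)
  then have "((\<lambda>x. if x \<in> {s..t} then g x else 0) has_integral integral {s..t} g) {s..s + 2 * pi}"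
    using has_integral_restrict[of "{s..t}" "{s..s + 2 * pi}" g] st by auto
  then have "((\<lambda>x. indicator (cis ` {s..t}) (cis x) * g x) has_integral integral {s..t} g) {s..s + 2 * pi}"
  proof (rule has_integral_spike_finite[where S = "{s + 2 * pi}", rotated 2])
    fix x assume x: "x \<in> {s..s + 2 * pi} - {s + 2 * pi}"
    have "cis x \<in> cis ` {s..t} \<longleftrightarrow> x \<in> {s..t}"
    proof
      assume "cis x \<in> cis ` {s..t}"
      then obtain y where y: "y \<in> {s..t}" "cis x = cis y" by auto
      show "x \<in> {s..t}"
      proof (cases "x \<le> y")
        case True
        then have "x = y" by (rule cis_eq_cis_imp_eq) (use x y st in auto)
        then show ?thesis using y by simp
      next
        case False
        then have "y = x" by (intro cis_eq_cis_imp_eq) (use x y st in auto)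
        then show ?thesis using y by simp
      qed
    qed auto
    then show "indicator (cis ` {s..t}) (cis x) * g x = (if x \<in> {s..t} then g x else 0)"
      by (auto simp: indicator_def)
  qed auto
  then show ?thesis
    using has_integral_periodic_shift[of "\<lambda>x. indicator (cis ` {s..t}) (cis x) * g x" "2 * pi" _ s 0] per
    by (simp add: cis_mult[symmetric])
qed

text \<open>The parametrisation of an arc is unique only up to multiples of \<open>2 * pi\<close>.  Keeping it as a
  parameter means that the results below hold for every choice, and this is what identifies the
  endpoints in the end without a uniqueness argument.\<close>

definition arc_param :: "complex set \<Rightarrow> (complex set \<Rightarrow> real) \<Rightarrow> (complex set \<Rightarrow> real) \<Rightarrow> bool" where
  "arc_param E s t \<longleftrightarrow>
     (\<forall>C\<in>components E. s C \<le> t C \<and> t C < s C + 2 * pi \<and> C = cis ` {s C..t C})"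

text \<open>One-point components have measure zero, so only the others contribute.\<close>

lemma has_integral_indicator_components:
  fixes g :: "real \<Rightarrow> complex"
  assumes g: "continuous_on UNIV g" and per: "\<And>x. g (x + 2 * pi) = g x"
    and fin: "finite (components E)"
    and param: "arc_param E s t"
  shows "((\<lambda>x. indicator E (cis x) * g x) has_integral
           (\<Sum>C | C \<in> components E \<and> \<not> is_singleton C. integral {s C..t C} g)) {0..2 * pi}"
proof -
  have st: "s C \<le> t C \<and> t C < s C + 2 * pi \<and> C = cis ` {s C..t C}" if "C \<in> components E" for C
    using param that by (simp add: arc_param_def)
  have "((\<lambda>x. \<Sum>C\<in>components E. indicator C (cis x) * g x) has_integral
           (\<Sum>C\<in>components E. integral {s C..t C} g)) {0..2 * pi}"
    by (rule has_integral_sum[OF fin]) (metis st has_integral_indicator_arc[OF g per])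
  moreover have "(\<Sum>C\<in>components E. indicator C (cis x) * g x) = indicator E (cis x) * g x" for x
  proof -
    have "(indicator E (cis x) :: complex) = indicator (\<Union>C\<in>components E. C) (cis x)"
      by simp
    also have "\<dots> = (\<Sum>C\<in>components E. indicator C (cis x))"
      by (rule indicator_UN_disjoint[OF fin])
         (auto simp: disjoint_family_on_def components_nonoverlap)
    finally show ?thesis by (simp add: sum_distrib_right)
  qed
  moreover have "(\<Sum>C\<in>components E. integral {s C..t C} g) =
      (\<Sum>C | C \<in> components E \<and> \<not> is_singleton C. integral {s C..t C} g)"
  proof (rule sum.mono_neutral_right)
    show "\<forall>C\<in>components E - {C \<in> components E. \<not> is_singleton C}. integral {s C..t C} g = 0"
    proof
      fix C assume C: "C \<in> components E - {C \<in> components E. \<not> is_singleton C}"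
      then have C': "s C \<le> t C" "t C < s C + 2 * pi" "C = cis ` {s C..t C}" using st by auto
      obtain x where "C = {x}" using C by (auto elim: is_singletonE)
      moreover have "cis (s C) \<in> cis ` {s C..t C}" "cis (t C) \<in> cis ` {s C..t C}"
        using C' by auto
      ultimately have "cis (s C) = cis (t C)" using C'(3) by auto
      then have "s C = t C" using cis_eq_cis_imp_eq C' by blast
      then show "integral {s C..t C} g = 0" by simp
    qed
  qed (use fin in auto)
  ultimately show ?thesis by simp
qed

text \<open>The Herglotz kernel; its real part is the Poisson kernel.\<close>

definition herglotz :: "complex \<Rightarrow> real \<Rightarrow> complex" where
  "herglotz z \<theta> = (1 + z * cis (- \<theta>)) / (1 - z * cis (- \<theta>))"

lemma one_minus_cis_nz: "norm z < 1 \<Longrightarrow> 1 - z * cis x \<noteq> 0"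
proof
  assume "norm z < 1" "1 - z * cis x = 0"
  then have "norm (z * cis x) = 1" by (metis eq_iff_diff_eq_0 norm_one)
  then show False using \<open>norm z < 1\<close> by (simp add: norm_mult)
qed

lemma continuous_on_herglotz: "norm z < 1 \<Longrightarrow> continuous_on A (herglotz z)"
  unfolding herglotz_def by (intro continuous_intros) (auto simp: one_minus_cis_nz[simplified])

lemma herglotz_periodic: "herglotz z (x + 2 * pi) = herglotz z x"
proof -
  have "cis (- (x + 2 * pi)) = cis (- x)"
    using cis_divide[of "- x" "2 * pi"] by simp
  then show ?thesis by (simp add: herglotz_def)
qed

lemma Re_herglotz_nonneg: "norm z < 1 \<Longrightarrow> Re (herglotz z x) \<ge> 0"
proof -
  assume z: "norm z < 1"
  define w where "w = z * cis (- x)"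
  have w: "norm w < 1" using z by (simp add: w_def norm_mult)
  have "Re ((1 + w) / (1 - w)) = (1 - (norm w)\<^sup>2) / (norm (1 - w))\<^sup>2"
    unfolding complex_div_cnj[of "1 + w" "1 - w"] Re_divide_of_real of_real_power[symmetric]
    unfolding cmod_power2[of w] by (simp add: power2_eq_square algebra_simps)
  also have "\<dots> \<ge> 0"
    using w by (intro divide_nonneg_nonneg) (auto simp: power_le_one)
  finally show ?thesis by (simp add: herglotz_def w_def)
qed

text \<open>With \<open>w = z * cis (- x)\<close> the kernel is \<open>1 + 2 * w / (1 - w)\<close>, which is the derivative of
  \<open>x - 2 * \<i> * Ln (1 - w)\<close>.\<close>

lemma has_integral_herglotz:
  assumes z: "norm z < 1" and st: "s \<le> t"
  shows "(herglotz z has_integral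
     (of_real (t - s) - 2 * \<i> * (Ln (1 - z * cis (- t)) - Ln (1 - z * cis (- s))))) {s..t}"
proof -
  define G where "G x = of_real x - 2 * \<i> * Ln (1 - z * cis (- x))" for x
  have "(herglotz z has_integral (G t - G s)) {s..t}"
  proof (rule fundamental_theorem_of_calculus[OF st])
    fix x
    have nz: "1 - z * cis (- x) \<noteq> 0" using one_minus_cis_nz[OF z] .
    have "Re (z * cis (- x)) < 1"
      using z complex_Re_le_cmod[of "z * cis (- x)"] by (simp add: norm_mult)
    then have off: "1 - z * cis (- x) \<notin> \<real>\<^sub>\<le>\<^sub>0"
      by (auto simp: complex_nonpos_Reals_iff)
    have cis': "((\<lambda>x. cis (- x)) has_vector_derivative - \<i> * cis (- x)) (at x within {s..t})"
      unfolding has_vector_derivative_def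
      by (auto intro!: derivative_eq_intros)
    have "((\<lambda>x. 1 - z * cis (- x)) has_vector_derivative - (z * (- \<i> * cis (- x)))) (at x within {s..t})"
      using has_vector_derivative_diff[OF has_vector_derivative_const has_vector_derivative_mult_right[OF cis']] by simp
    then have "((Ln \<circ> (\<lambda>x. 1 - z * cis (- x))) has_vector_derivative
        - (z * (- \<i> * cis (- x))) * inverse (1 - z * cis (- x))) (at x within {s..t})"
      by (rule field_vector_diff_chain_within)
         (auto intro!: has_field_derivative_at_within has_field_derivative_Ln off)
    then have "(G has_vector_derivative
       1 - 2 * \<i> * (- (z * (- \<i> * cis (- x))) * inverse (1 - z * cis (- x)))) (at x within {s..t})"
      unfolding G_def o_def
      by (intro has_vector_derivative_diff has_vector_derivative_mult_right)
         (auto intro!: has_vector_derivative_of_real[THEN has_vector_derivative_eq_rhs] derivative_eq_intros)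
    moreover have "1 - 2 * \<i> * (- (z * (- \<i> * cis (- x))) * inverse (1 - z * cis (- x))) = herglotz z x"
      using nz by (simp add: herglotz_def field_simps)
    ultimately show "(G has_vector_derivative herglotz z x) (at x within {s..t})" by simp
  qed
  then show ?thesis by (simp add: G_def algebra_simps)
qed

lemma integral_herglotz_circle:
  assumes "norm z < 1"
  shows "(herglotz z has_integral 2 * pi) {0..2 * pi}"
proof -
  have "cis (- (2 * pi)) = 1" by (simp add: cis.ctr complex_eq_iff)
  then show ?thesis using has_integral_herglotz[OF assms, of 0 "2 * pi"] by simp
qed

section \<open>The Herglotz representation of the function $h_E$\<close>

definition circle_integrable :: "complex set \<Rightarrow> bool" where
  "circle_integrable E \<longleftrightarrow>
     (\<forall>g. continuous_on UNIV g \<and> (\<forall>x. g (x + 2 * pi) = g x) \<longrightarrow>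
        (\<lambda>x. indicator E (cis x) * g x :: complex) integrable_on {0..2 * pi})"

text \<open>Summing the geometric series under the integral sign, which dominated convergence permits
  inside the disc.\<close>

lemma h_fun_herglotz:
  assumes E: "circle_integrable E"
    and z: "norm z < 1"
  shows "summable (\<lambda>k. fourier_coeff E (int k) * z ^ k)"
    and "h_fun E z = 1 / (4 * pi) * integral {0..2 * pi} (\<lambda>x. indicator E (cis x) * herglotz z x)"
proof -
  define ind where "ind x = (indicator E (cis x) :: complex)" for x
  define S where "S n x = 1 / 2 + (\<Sum>k<n. (z * cis (- x)) ^ Suc k)" for n x
  have cis_per: "cis (- x - 2 * pi) = cis (- x)" for x
    using cis_divide[of "- x" "2 * pi"] by simp
  have int1: "(\<lambda>x. ind x * g x) integrable_on {0..2 * pi}"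
    if "continuous_on UNIV g" "\<And>x. g (x + 2 * pi) = g x" for g :: "real \<Rightarrow> complex"
    unfolding ind_def using E that by (simp add: circle_integrable_def)
  have fc: "fourier_coeff E (int k) = 1 / (2 * pi) * integral {0..2 * pi} (\<lambda>x. ind x * cis (- x) ^ k)" for k
  proof -
    have "exp (- \<i> * of_int (int k) * of_real t) = cis (- t) ^ k" for t
      by (simp add: cis_conv_exp exp_of_nat_mult[symmetric] mult_ac)
    then show ?thesis unfolding fourier_coeff_def ind_def by simp
  qed
  have int2: "(\<lambda>x. ind x * S n x) integrable_on {0..2 * pi}" for n
    by (rule int1) (auto simp: S_def cis_per intro!: continuous_intros)
  have part: "1 / (2 * pi) * integral {0..2 * pi} (\<lambda>x. ind x * S n x) =
      1 / 2 * fourier_coeff E 0 + (\<Sum>k<n. fourier_coeff E (int (Suc k)) * z ^ Suc k)" for n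
  proof -
    have "ind x * S n x = ind x * cis (- x) ^ 0 * (1/2) + (\<Sum>k<n. ind x * cis (- x) ^ Suc k * z ^ Suc k)" for x
      by (simp add: S_def algebra_simps sum_distrib_left power_mult_distrib)
    moreover have "((\<lambda>x. ind x * cis (- x) ^ 0 * (1/2) + (\<Sum>k<n. ind x * cis (- x) ^ Suc k * z ^ Suc k))
       has_integral (integral {0..2 * pi} (\<lambda>x. ind x * cis (- x) ^ 0) * (1/2) +
        (\<Sum>k<n. integral {0..2 * pi} (\<lambda>x. ind x * cis (- x) ^ Suc k) * z ^ Suc k))) {0..2 * pi}"
      by (intro has_integral_add has_integral_sum has_integral_mult_left integrable_integral int1)
         (auto simp: cis_per intro!: continuous_intros)
    ultimately have "integral {0..2 * pi} (\<lambda>x. ind x * S n x) =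
        integral {0..2 * pi} (\<lambda>x. ind x * cis (- x) ^ 0) * (1/2) +
        (\<Sum>k<n. integral {0..2 * pi} (\<lambda>x. ind x * cis (- x) ^ Suc k) * z ^ Suc k)"
      by (simp only: integral_unique)
    then show ?thesis
      unfolding fc fc[of 0, simplified] by (simp add: sum_distrib_left algebra_simps)
  qed
  have lim: "(\<lambda>n. integral {0..2 * pi} (\<lambda>x. ind x * S n x)) \<longlonglongrightarrow>
      integral {0..2 * pi} (\<lambda>x. ind x * (herglotz z x / 2))"
  proof (rule dominated_convergence(2)[OF int2])
    show "(\<lambda>_. 1 / 2 + 1 / (1 - norm z)) integrable_on {0..2 * pi}"
      by (rule integrable_const_ivl)
    fix n x
    have ind: "norm (ind x) \<le> 1" by (simp add: ind_def indicator_def)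
    have "norm (S n x) \<le> 1 / 2 + norm (\<Sum>k<n. (z * cis (- x)) ^ Suc k)"
      unfolding S_def by (rule order_trans[OF norm_triangle_ineq]) simp
    also have "norm (\<Sum>k<n. (z * cis (- x)) ^ Suc k) \<le> (\<Sum>k<n. norm z ^ k)"
      by (rule sum_norm_le) (use z in \<open>auto simp: norm_mult norm_power mult_left_le_one_le\<close>)
    also have "\<dots> \<le> (\<Sum>k. norm z ^ k)"
      using z by (intro sum_le_suminf summable_geometric) auto
    also have "\<dots> = 1 / (1 - norm z)"
      using z by (intro suminf_geometric) auto
    finally have S: "norm (S n x) \<le> 1 / 2 + 1 / (1 - norm z)" by simp
    then show "norm (ind x * S n x) \<le> 1 / 2 + 1 / (1 - norm z)"
      using mult_mono[OF ind S] by (simp add: norm_mult)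
  next
    fix x
    define w where "w = z * cis (- x)"
    have w: "norm w < 1" using z by (simp add: w_def norm_mult)
    have "(\<lambda>k. w * w ^ k) sums (w * (1 / (1 - w)))"
      using w by (intro sums_mult geometric_sums)
    then have "(\<lambda>n. 1 / 2 + (\<Sum>k<n. w ^ Suc k)) \<longlonglongrightarrow> 1 / 2 + w * (1 / (1 - w))"
      by (intro tendsto_intros) (simp add: sums_def)
    also have "1 / 2 + w * (1 / (1 - w)) = herglotz z x / 2"
      using one_minus_cis_nz[OF z, of "- x"] by (simp add: herglotz_def w_def field_simps)
    finally show "(\<lambda>n. ind x * S n x) \<longlonglongrightarrow> ind x * (herglotz z x / 2)"
      unfolding S_def w_def by (rule tendsto_mult[OF tendsto_const])
  qed
  from tendsto_mult[OF tendsto_const[of "of_real (1 / (2 * pi)) :: complex"] lim]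
  have "(\<lambda>n. 1 / 2 * fourier_coeff E 0 + (\<Sum>k<n. fourier_coeff E (int (Suc k)) * z ^ Suc k)) \<longlonglongrightarrow>
      1 / (2 * pi) * integral {0..2 * pi} (\<lambda>x. ind x * (herglotz z x / 2))"
    using part by simp
  from tendsto_add[OF tendsto_const[of "- (1 / 2 * fourier_coeff E 0)"] this]
  have sums: "(\<lambda>k. fourier_coeff E (int (Suc k)) * z ^ Suc k) sums
      (- (1 / 2 * fourier_coeff E 0) + 1 / (2 * pi) * integral {0..2 * pi} (\<lambda>x. ind x * (herglotz z x / 2)))"
    by (simp add: sums_def)
  then have "summable (\<lambda>k. fourier_coeff E (int (Suc k)) * z ^ Suc k)"
    by (rule sums_summable)
  then show "summable (\<lambda>k. fourier_coeff E (int k) * z ^ k)"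
    by (subst (asm) summable_Suc_iff)
  have "h_fun E z = 1 / (2 * pi) * integral {0..2 * pi} (\<lambda>x. ind x * (herglotz z x / 2))"
    unfolding h_fun_def sums_unique[OF sums, symmetric] by simp
  also have "integral {0..2 * pi} (\<lambda>x. ind x * (herglotz z x / 2)) = integral {0..2 * pi} (\<lambda>x. ind x * herglotz z x) / 2"
    using integral_mult_left[of "{0..2 * pi}" "\<lambda>x. ind x * herglotz z x" "1 / 2"] by simp
  finally show "h_fun E z = 1 / (4 * pi) * integral {0..2 * pi} (\<lambda>x. indicator E (cis x) * herglotz z x)"
    by (simp add: ind_def)
qed

text \<open>The indicator takes values in \<open>[0, 1]\<close>, the kernel has nonnegative real part and integral
  \<open>2 * pi\<close>.\<close>

lemma Re_h_fun_bounds: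
  assumes E: "circle_integrable E"
    and z: "norm z < 1"
  shows "0 \<le> Re (h_fun E z)" "Re (h_fun E z) \<le> 1 / 2"
proof -
  let ?I = "integral {0..2 * pi} (\<lambda>x. indicator E (cis x) * herglotz z x)"
  have "((\<lambda>x. indicator E (cis x) * herglotz z x) has_integral ?I) {0..2 * pi}"
    using E continuous_on_herglotz[OF z] herglotz_periodic
    by (intro integrable_integral) (simp add: circle_integrable_def)
  from has_integral_Re[OF this]
  have 1: "((\<lambda>x. indicator E (cis x) * Re (herglotz z x)) has_integral Re ?I) {0..2 * pi}"
    by (rule has_integral_eq[rotated]) (auto simp: indicator_def)
  have 2: "((\<lambda>x. Re (herglotz z x)) has_integral 2 * pi) {0..2 * pi}"
    using has_integral_Re[OF integral_herglotz_circle[OF z]] by simp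
  have "0 \<le> Re ?I"
    by (rule has_integral_nonneg[OF 1]) (simp add: Re_herglotz_nonneg z)
  moreover have "Re ?I \<le> 2 * pi"
    by (rule has_integral_le[OF 1 2]) (simp add: Re_herglotz_nonneg z indicator_def)
  moreover have Re: "Re (h_fun E z) = Re ?I / (4 * pi)"
  proof -
    have "h_fun E z = complex_of_real (1 / (4 * pi)) * ?I"
      using h_fun_herglotz(2)[OF E z] by simp
    then show ?thesis by simp
  qed
  ultimately show "0 \<le> Re (h_fun E z)" "Re (h_fun E z) \<le> 1 / 2"
    unfolding Re by (simp_all add: pos_divide_le_eq)
qed

lemma circle_integrable_components:
  assumes "finite (components E)" "arc_param E s t"
  shows "circle_integrable E"
  unfolding circle_integrable_def
proof (intro allI impI, elim conjE)
  fix g :: "real \<Rightarrow> complex"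
  assume g: "continuous_on UNIV g" and per: "\<forall>x. g (x + 2 * pi) = g x"
  show "(\<lambda>x. indicator E (cis x) * g x) integrable_on {0..2 * pi}"
    by (rule has_integral_integrable[OF has_integral_indicator_components[OF g _ assms]]) (use per in simp)
qed

lemma exp_h_fun_components:
  assumes fin: "finite (components E)"
    and param: "arc_param E s t"
    and z: "norm z < 1"
  defines "K \<equiv> {C \<in> components E. \<not> is_singleton C}"
  shows "exp (2 * pi * \<i> * h_fun E z) * (\<Prod>C\<in>K. 1 - cis (- s C) * z) =
     (\<Prod>C\<in>K. cis ((t C - s C) / 2) * (1 - cis (- t C) * z))"
proof -
  have int: "((\<lambda>x. indicator E (cis x) * g x) has_integral (\<Sum>C\<in>K. integral {s C..t C} g)) {0..2 * pi}"
    if "continuous_on UNIV g" "\<And>x. g (x + 2 * pi) = g x" for g :: "real \<Rightarrow> complex"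
    unfolding K_def by (rule has_integral_indicator_components[OF that fin param])
  have "2 * pi * \<i> * h_fun E z = \<i> / 2 * (\<Sum>C\<in>K. integral {s C..t C} (herglotz z))"
    using h_fun_herglotz(2)[OF circle_integrable_components[OF fin param] z]
      integral_unique[OF int[OF continuous_on_herglotz[OF z] herglotz_periodic]] by simp
  also have "\<dots> = (\<Sum>C\<in>K. \<i> * of_real ((t C - s C) / 2) + (Ln (1 - z * cis (- t C)) - Ln (1 - z * cis (- s C))))"
    unfolding sum_distrib_left
  proof (rule sum.cong[OF refl])
    fix C assume "C \<in> K"
    then have "s C \<le> t C" using param by (auto simp: K_def arc_param_def)
    then show "\<i> / 2 * integral {s C..t C} (herglotz z) =
       \<i> * of_real ((t C - s C) / 2) + (Ln (1 - z * cis (- t C)) - Ln (1 - z * cis (- s C)))"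
      unfolding integral_unique[OF has_integral_herglotz[OF z \<open>s C \<le> t C\<close>]] by (simp add: field_simps)
  qed
  finally have eq: "2 * pi * \<i> * h_fun E z = \<dots>" .
  have nz: "1 - z * cis x \<noteq> 0" for x using one_minus_cis_nz[OF z] .
  have fac: "exp (\<i> * of_real r + (Ln (1 - z * cis x) - Ln (1 - z * cis y))) =
      cis r * (1 - cis x * z) / (1 - cis y * z)" for r x y
    unfolding exp_add exp_diff exp_Ln[OF nz] cis_conv_exp[symmetric] by (simp add: mult.commute)
  have "exp (2 * pi * \<i> * h_fun E z) =
      (\<Prod>C\<in>K. cis ((t C - s C) / 2) * (1 - cis (- t C) * z) / (1 - cis (- s C) * z))"
    unfolding eq by (subst exp_sum) (use fin in \<open>simp add: K_def\<close>, simp only: fac)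
  moreover have "(\<Prod>C\<in>K. 1 - cis (- s C) * z) \<noteq> 0"
    using fin nz by (auto simp: K_def mult.commute)
  ultimately show ?thesis by (simp add: prod_dividef)
qed

section \<open>Blaschke products as quotients of polynomials\<close>

text \<open>Here \<open>q\<close> is the polynomial \<open>p\<close> with conjugated coefficients in reversed order, reversed with
  respect to the formal degree \<open>N\<close>, which may exceed the degree of \<open>p\<close>.\<close>

definition conj_reflection :: "nat \<Rightarrow> complex poly \<Rightarrow> complex poly \<Rightarrow> bool" where
  "conj_reflection N p q \<longleftrightarrow> (\<forall>z. z \<noteq> 0 \<longrightarrow> poly q z = z ^ N * cnj (poly p (1 / cnj z)))"

lemma poly_eqI_nonzero:
  fixes p q :: "complex poly"
  assumes "\<And>z. z \<noteq> 0 \<Longrightarrow> poly p z = poly q z"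
  shows "p = q"
proof -
  have "poly ([:0, 1:] * (p - q)) z = 0" for z
    using assms[of z] by (cases "z = 0") auto
  then have "[:0, 1:] * (p - q) = 0" using poly_all_0_iff_0 by blast
  then show ?thesis by simp
qed

text \<open>Denominator and numerator of a Blaschke product of order \<open>N\<close>.  Unlike the quotient as a total
  function, the pair can be multiplied out, compared and reduced as polynomials.\<close>

definition blaschke_pair :: "nat \<Rightarrow> complex poly \<Rightarrow> complex poly \<Rightarrow> bool" where
  "blaschke_pair N A B \<longleftrightarrow> (\<exists>a d e. (\<forall>j\<in>{1..N}. norm (a j) < 1) \<and> d \<noteq> 0 \<and> norm e = norm d \<and>
     A = Polynomial.smult d (\<Prod>j=1..N. [:1, - cnj (a j):]) \<and> B = Polynomial.smult e (\<Prod>j=1..N. [:- a j, 1:]))"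

text \<open>The roots of \<open>A\<close> lie outside the closed disc, so \<open>A\<close> is a product of factors
  \<open>1 - cnj (a j) * z\<close>; reflection turns each of them into \<open>z - a j\<close>.  If the degree of \<open>A\<close> is less
  than \<open>N\<close>, the missing factors have \<open>a j = 0\<close>.\<close>

lemma blaschke_pair_of_reflection:
  assumes deg: "degree A \<le> N" and nz: "\<And>z. norm z \<le> 1 \<Longrightarrow> poly A z \<noteq> 0"
    and refl: "conj_reflection N A (Polynomial.smult w B)" and w: "norm w = 1"
  shows "blaschke_pair N A B"
proof -
  define k where "k = degree A"
  obtain root where root: "Polynomial.smult (lead_coeff A) (\<Prod>i<k. [:- root i, 1:]) = A"
    unfolding k_def by (rule complex_poly_decompose')
  have big: "norm (root i) > 1" if "i < k" for i
  proof (rule ccontr)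
    assume "\<not> ?thesis"
    moreover have "poly A (root i) = 0"
      by (subst root[symmetric]) (use that in \<open>auto simp: poly_prod\<close>)
    ultimately show False using nz by force
  qed
  define a where "a j = (if j \<le> k then 1 / cnj (root (j - 1)) else 0)" for j
  define d where "d = lead_coeff A * (\<Prod>i<k. - root i)"
  have a: "norm (a j) < 1" if "j \<in> {1..N}" for j
    using that big[of "j - 1"] by (auto simp: a_def norm_divide divide_simps)
  have "A \<noteq> 0" using nz[of 0] by auto
  then have d: "d \<noteq> 0" using big by (force simp: d_def)
  have "(\<Prod>j=1..N. [:1, - cnj (a j):]) = (\<Prod>j=1..k. [:1, - cnj (a j):])"
    by (rule prod.mono_neutral_right) (use deg in \<open>auto simp: k_def a_def one_pCons\<close>)
  also have "\<dots> = (\<Prod>i<k. [:1, - 1 / root i:])"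
    by (rule prod.reindex_bij_witness[of _ Suc "\<lambda>j. j - 1"]) (auto simp: a_def)
  finally have "Polynomial.smult d (\<Prod>j=1..N. [:1, - cnj (a j):]) = Polynomial.smult (lead_coeff A) (\<Prod>i<k. Polynomial.smult (- root i) [:1, - 1 / root i:])"
    unfolding d_def prod_smult smult_smult by simp
  also have "(\<Prod>i<k. Polynomial.smult (- root i) [:1, - 1 / root i:]) = (\<Prod>i<k. [:- root i, 1:])"
    using big by (intro prod.cong) force+
  finally have A: "A = Polynomial.smult d (\<Prod>j=1..N. [:1, - cnj (a j):])" using root by simp
  have "B = Polynomial.smult (cnj d / w) (\<Prod>j=1..N. [:- a j, 1:])"
  proof (rule poly_eqI_nonzero)
    fix z :: complex assume z: "z \<noteq> 0"
    have "w * poly B z = z ^ N * cnj (poly A (1 / cnj z))"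
      using refl z by (simp add: conj_reflection_def)
    also have "\<dots> = cnj d * (\<Prod>j=1..N. z * (1 - a j / z))"
      by (subst A) (simp add: poly_prod prod.distrib)
    also have "(\<Prod>j=1..N. z * (1 - a j / z)) = (\<Prod>j=1..N. z - a j)"
      using z by (intro prod.cong) (auto simp: field_simps)
    finally show "poly B z = poly (Polynomial.smult (cnj d / w) (\<Prod>j=1..N. [:- a j, 1:])) z"
      using w by (cases "w = 0") (auto simp: poly_prod field_simps)
  qed
  with A a d show ?thesis
    unfolding blaschke_pair_def using w
    by (intro exI[of _ a] exI[of _ d] exI[of _ "cnj d / w"]) (auto simp: norm_divide)
qed

text \<open>The equality of total functions includes the poles, where both sides are 0 by the convention
  for division by zero.\<close>

lemma blaschke_product_iff_pair:
  "blaschke_product N b \<longleftrightarrow> (\<exists>A B. blaschke_pair N A B \<and> b = (\<lambda>z. poly B z / poly A z))"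
proof
  assume "blaschke_product N b"
  then obtain u a where u: "norm u = 1" and a: "\<forall>j\<in>{1..N}. norm (a j) < 1"
    and b: "b = (\<lambda>z. u * (\<Prod>j=1..N. (z - a j) / (1 - cnj (a j) * z)))"
    unfolding blaschke_product_def by blast
  have "blaschke_pair N (Polynomial.smult 1 (\<Prod>j=1..N. [:1, - cnj (a j):])) (Polynomial.smult u (\<Prod>j=1..N. [:- a j, 1:]))"
    unfolding blaschke_pair_def using u a by (intro exI[of _ a] exI[of _ 1] exI[of _ u]) auto
  moreover have "b = (\<lambda>z. poly (Polynomial.smult u (\<Prod>j=1..N. [:- a j, 1:])) z / poly (Polynomial.smult 1 (\<Prod>j=1..N. [:1, - cnj (a j):])) z)"
    unfolding b by (simp add: poly_prod prod_dividef mult.commute)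
  ultimately show "\<exists>A B. blaschke_pair N A B \<and> b = (\<lambda>z. poly B z / poly A z)" by blast
next
  assume "\<exists>A B. blaschke_pair N A B \<and> b = (\<lambda>z. poly B z / poly A z)"
  then obtain a d e where *: "\<forall>j\<in>{1..N}. norm (a j) < 1" "d \<noteq> 0" "norm e = norm d"
    "b = (\<lambda>z. poly (Polynomial.smult e (\<Prod>j=1..N. [:- a j, 1:])) z / poly (Polynomial.smult d (\<Prod>j=1..N. [:1, - cnj (a j):])) z)"
    unfolding blaschke_pair_def by blast
  have "b = (\<lambda>z. e / d * (\<Prod>j=1..N. (z - a j) / (1 - cnj (a j) * z)))"
    unfolding *(4) by (simp add: poly_prod prod_dividef mult.commute)
  then show "blaschke_product N b"
    unfolding blaschke_product_def using *(1-3)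
    by (intro exI[of _ "e / d"] exI[of _ a]) (auto simp: norm_divide)
qed

lemma blaschke_pair_nonzero:
  assumes "blaschke_pair N A B"
  shows "norm z \<le> 1 \<Longrightarrow> poly A z \<noteq> 0" "norm z \<ge> 1 \<Longrightarrow> poly B z \<noteq> 0"
proof -
  obtain a d e where *: "\<forall>j\<in>{1..N}. norm (a j) < 1" "d \<noteq> 0" "norm e = norm d"
    "A = Polynomial.smult d (\<Prod>j=1..N. [:1, - cnj (a j):])" "B = Polynomial.smult e (\<Prod>j=1..N. [:- a j, 1:])"
    using assms unfolding blaschke_pair_def by blast
  show "poly A z \<noteq> 0" if z: "norm z \<le> 1"
  proof
    assume "poly A z = 0"
    then obtain j where j: "j \<in> {1..N}" "z * cnj (a j) = 1"
      using * by (auto simp: poly_prod)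
    then have "norm z * norm (a j) = 1" by (metis complex_mod_cnj norm_mult norm_one)
    moreover have "norm z * norm (a j) \<le> norm (a j)" using z by (simp add: mult_left_le_one_le)
    ultimately show False using * j by force
  qed
  show "poly B z \<noteq> 0" if "norm z \<ge> 1"
    using * that by (force simp: poly_prod)
qed

lemma blaschke_pair_norm_circle:
  assumes "blaschke_pair N A B" and z: "norm z = 1"
  shows "norm (poly B z) = norm (poly A z)"
proof -
  obtain a d e where *: "\<forall>j\<in>{1..N}. norm (a j) < 1" "d \<noteq> 0" "norm e = norm d"
    "A = Polynomial.smult d (\<Prod>j=1..N. [:1, - cnj (a j):])" "B = Polynomial.smult e (\<Prod>j=1..N. [:- a j, 1:])"
    using assms unfolding blaschke_pair_def by blast
  have "norm (z - x) = norm (1 - z * cnj x)" for x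
  proof -
    have "z * cnj z = 1" using z by (simp add: complex_norm_square[symmetric])
    then have "z - x = z * cnj (1 - z * cnj x)"
      by (simp add: algebra_simps)
    then show ?thesis using z by (metis complex_mod_cnj mult_1 norm_mult)
  qed
  then show ?thesis
    using * by (simp add: poly_prod norm_mult prod_norm[symmetric])
qed

lemma coprime_poly_no_common_root:
  fixes p q :: "complex poly"
  assumes "\<And>z. poly p z \<noteq> 0 \<or> poly q z \<noteq> 0"
  shows "coprime p q"
proof (rule coprimeI)
  fix r assume r: "r dvd p" "r dvd q"
  have "r \<noteq> 0" using r assms by auto
  moreover have "\<not> degree r > 0"
  proof
    assume "degree r > 0"
    then obtain z where "poly r z = 0"
      using fundamental_theorem_of_algebra constant_degree by (metis less_irrefl)
    then show False using r assms by (metis dvd_trans poly_eq_0_iff_dvd)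
  qed
  ultimately show "is_unit r" by (simp add: is_unit_iff_degree)
qed

lemma blaschke_pair_coprime:
  assumes "blaschke_pair N A B"
  shows "coprime A B"
  using blaschke_pair_nonzero[OF assms] by (intro coprime_poly_no_common_root) (meson linear)

lemma blaschke_pair_degree:
  assumes "blaschke_pair N A B"
  shows "degree A \<le> N" "degree B = N" "poly B 0 \<noteq> 0 \<Longrightarrow> degree A = N"
proof -
  obtain a d e where *: "\<forall>j\<in>{1..N}. norm (a j) < 1" "d \<noteq> 0" "norm e = norm d"
    "A = Polynomial.smult d (\<Prod>j=1..N. [:1, - cnj (a j):])" "B = Polynomial.smult e (\<Prod>j=1..N. [:- a j, 1:])"
    using assms unfolding blaschke_pair_def by blast
  have "e \<noteq> 0" using * by auto
  then show "degree B = N" using * by (simp add: degree_prod_eq_sum_degree)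
  have A: "degree A = (\<Sum>j=1..N. degree [:1, - cnj (a j):])"
    using * by (subst degree_prod_eq_sum_degree[symmetric]) auto
  also have "\<dots> \<le> (\<Sum>j=1..N. 1)" by (rule sum_mono) simp
  finally show "degree A \<le> N" by simp
  assume "poly B 0 \<noteq> 0"
  then have "a j \<noteq> 0" if "j \<in> {1..N}" for j
    using * that by (force simp: poly_prod)
  then have "(\<Sum>j=1..N. degree [:1, - cnj (a j):]) = (\<Sum>j=1..N. 1)"
    by (intro sum.cong) auto
  then show "degree A = N" using A by simp
qed

text \<open>Cross multiplication gives a polynomial identity on the disc, hence everywhere.  Outside the
  disc both numerators are nonzero, so the identity forces the denominators to vanish together.\<close>

lemma blaschke_pair_unique:
  assumes p: "blaschke_pair N A B" and p': "blaschke_pair N' A' B'"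
    and eq: "\<And>z. norm z < 1 \<Longrightarrow> poly B z / poly A z = poly B' z / poly A' z"
  shows "poly B z / poly A z = poly B' z / poly A' z"
proof -
  have "poly (B * A' - B' * A) z = 0" if "norm z < 1" for z
    using eq[OF that] that blaschke_pair_nonzero(1)[OF p, of z] blaschke_pair_nonzero(1)[OF p', of z]
    by (simp add: frac_eq_eq)
  then have "ball 0 1 \<subseteq> {z. poly (B * A' - B' * A) z = 0}" by auto
  moreover have "infinite (ball (0::complex) 1)"
    using uncountable_ball[of 1 "0::complex"] countable_finite by auto
  ultimately have "B * A' - B' * A = 0"
    using poly_roots_finite finite_subset by blast
  then have cross: "poly B z * poly A' z = poly B' z * poly A z"
    by (metis eq_iff_diff_eq_0 poly_mult)
  show ?thesis
  proof (cases "norm z \<le> 1")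
    case True
    then show ?thesis
      using cross blaschke_pair_nonzero(1)[OF p, of z] blaschke_pair_nonzero(1)[OF p', of z]
      by (simp add: frac_eq_eq)
  next
    case False
    then have "poly B z \<noteq> 0" "poly B' z \<noteq> 0"
      using blaschke_pair_nonzero(2)[OF p, of z] blaschke_pair_nonzero(2)[OF p', of z] by auto
    then show ?thesis
      using cross by (cases "poly A z = 0"; cases "poly A' z = 0") (auto simp: frac_eq_eq)
  qed
qed

lemma b_fun_eqI:
  assumes p: "blaschke_pair N A B" and eq: "\<And>z. norm z < 1 \<Longrightarrow> poly B z / poly A z = phi (h_fun E z)"
  shows "b_fun E = (\<lambda>z. poly B z / poly A z)" "blaschke_extension E (b_fun E)"
proof -
  have ext: "blaschke_extension E (\<lambda>z. poly B z / poly A z)"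
    unfolding blaschke_extension_def blaschke_product_iff_pair using p eq by auto
  moreover have "b = (\<lambda>z. poly B z / poly A z)" if b: "blaschke_extension E b" for b
  proof -
    obtain N' A' B' where p': "blaschke_pair N' A' B'" and b': "b = (\<lambda>z. poly B' z / poly A' z)"
      and "\<forall>z\<in>ball 0 1. b z = phi (h_fun E z)"
      using b unfolding blaschke_extension_def blaschke_product_iff_pair by auto
    then have "poly B' z / poly A' z = poly B z / poly A z" if "norm z < 1" for z
      using eq[OF that] that by auto
    from blaschke_pair_unique[OF p' p this] show ?thesis unfolding b' by blast
  qed
  ultimately show "b_fun E = (\<lambda>z. poly B z / poly A z)"
    unfolding b_fun_def by (rule the_equality)
  with ext show "blaschke_extension E (b_fun E)" by simp
qed

section \<open>Projection onto the polynomials of bounded degree\<close>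

text \<open>Cauchy's integral formula at the centre.\<close>

lemma circle_mean_value:
  fixes F :: "complex \<Rightarrow> complex"
  assumes "continuous_on (cball 0 1) F" "F holomorphic_on ball 0 1"
  shows "((\<lambda>t. F (cis t)) has_integral 2 * pi * F 0) {0..2 * pi}"
proof -
  have "((\<lambda>u. F u / (u - 0)) has_contour_integral 2 * complex_of_real pi * \<i> * F 0) (circlepath 0 1)"
    by (rule Cauchy_integral_circlepath) (use assms in auto)
  then have "((\<lambda>t. F (cis t) * \<i>) has_integral 2 * complex_of_real pi * \<i> * F 0) {0..2 * pi}"
    unfolding circlepath_def by (simp add: has_contour_integral_part_circlepath_iff mult.assoc)
  from has_integral_mult_left[OF this, of "- \<i>"]
  have "((\<lambda>t. F (cis t) * \<i> * - \<i>) has_integral (2 * complex_of_real pi * F 0) * (\<i> * - \<i>)) {0..2 * pi}"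
    by (simp only: mult_ac)
  then show ?thesis by (simp add: mult.assoc)
qed

lemma poly_eq_0_on_circle:
  fixes p :: "complex poly"
  assumes "\<And>t. 0 \<le> t \<Longrightarrow> t \<le> 2 * pi \<Longrightarrow> poly p (cis t) = 0"
  shows "p = 0"
proof (rule ccontr)
  assume "p \<noteq> 0"
  then have "finite (cis ` {0..1})"
    using assms pi_gt3 by (intro finite_subset[OF _ poly_roots_finite[of p]]) auto
  moreover have "inj_on cis {0..1}"
  proof
    fix x y :: real assume "x \<in> {0..1}" "y \<in> {0..1}" "cis x = cis y"
    then show "x = y"
      using pi_gt3 cis_eq_cis_imp_eq[of x y] cis_eq_cis_imp_eq[of y x] by (cases "x \<le> y") auto
  qed
  ultimately have "finite {0..1::real}" by (metis finite_imageD)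
  then show False by (simp add: infinite_Icc)
qed

lemma integral_norm_square_eq_0:
  fixes f :: "real \<Rightarrow> complex"
  assumes "continuous_on {a..b} f" "a < b" "integral {a..b} (\<lambda>t. (norm (f t))\<^sup>2) = 0" "t \<in> {a..b}"
  shows "f t = 0"
proof -
  have "continuous_on {a..b} (\<lambda>t. (norm (f t))\<^sup>2)"
    by (intro continuous_on_power continuous_on_norm assms(1))
  from integral_eq_0_iff[OF this] have "(norm (f t))\<^sup>2 = 0"
    using assms(2-4) by simp
  then show ?thesis by simp
qed

lemma poly_eq_0_integral:
  fixes r :: "complex poly"
  assumes zero: "integral {0..2 * pi} (\<lambda>t. (norm (poly r (cis t)))\<^sup>2) = 0"
  shows "r = 0"
proof (rule poly_eq_0_on_circle)
  fix t :: real assume t: "0 \<le> t" "t \<le> 2 * pi"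
  have cont: "continuous_on {0..2 * pi} (\<lambda>t. poly r (cis t))"
    by (intro continuous_on_poly continuous_on_cis continuous_on_id)
  show "poly r (cis t) = 0"
    using integral_norm_square_eq_0[of 0 "2 * pi" "\<lambda>t. poly r (cis t)" t, OF cont _ zero] t
    by (simp only: pi_gt_zero zero_less_mult_iff zero_less_numeral simp_thms atLeastAtMost_iff)
qed

lemma continuous_on_cis_comp:
  assumes "continuous_on unit_circle f"
  shows "continuous_on A (\<lambda>t. f (cis t))"
proof (rule continuous_on_compose2[OF assms])
  show "continuous_on A cis" by (rule continuous_on_cis[OF continuous_on_id])
  show "cis ` A \<subseteq> unit_circle" by auto
qed

lemma orth_proj_eqI:
  assumes p: "p \<in> polys n" and g: "continuous_on unit_circle g"
    and orth: "\<And>r. r \<in> polys n \<Longrightarrow> circle_inner (\<lambda>z. g z - poly p z) (poly r) = 0"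
  shows "orth_proj n g = p"
  unfolding orth_proj_def
proof (rule the_equality)
  show "p \<in> polys n \<and> (\<forall>r\<in>polys n. circle_inner (\<lambda>z. g z - poly p z) (poly r) = 0)"
    using p orth by blast
next
  fix q assume q: "q \<in> polys n \<and> (\<forall>r\<in>polys n. circle_inner (\<lambda>z. g z - poly q z) (poly r) = 0)"
  define r where "r = p - q"
  have r: "r \<in> polys n" using p q by (auto simp: r_def polys_def intro: degree_diff_le)
  have int: "(\<lambda>t. (g (cis t) - poly s (cis t)) * cnj (poly r (cis t))) integrable_on {0..2 * pi}" for s
    by (intro integrable_continuous_real continuous_on_mult continuous_on_diff continuous_on_cis_comp[OF g]
        continuous_on_cnj continuous_on_poly continuous_on_cis continuous_on_id)
  have 0: "integral {0..2 * pi} (\<lambda>t. (g (cis t) - poly q (cis t)) * cnj (poly r (cis t))) = 0"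
       "integral {0..2 * pi} (\<lambda>t. (g (cis t) - poly p (cis t)) * cnj (poly r (cis t))) = 0"
    using q orth r by (auto simp: circle_inner_def)
  have "integral {0..2 * pi} (\<lambda>t. (g (cis t) - poly q (cis t)) * cnj (poly r (cis t)) -
      (g (cis t) - poly p (cis t)) * cnj (poly r (cis t))) = 0"
    by (simp only: integral_diff[OF int[of q] int[of p]] 0 diff_self)
  moreover have "(g x - poly q x) * cnj (poly r x) - (g x - poly p x) * cnj (poly r x) =
      complex_of_real ((norm (poly r x))\<^sup>2)" for x
  proof -
    have "(g x - poly q x) - (g x - poly p x) = poly r x" by (simp add: r_def)
    then show ?thesis by (simp only: complex_norm_square left_diff_distrib[symmetric])
  qed
  ultimately have "integral {0..2 * pi} (\<lambda>t. complex_of_real ((norm (poly r (cis t)))\<^sup>2)) = 0"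
    by simp
  moreover have "integral {0..2 * pi} (\<lambda>t. complex_of_real ((norm (poly r (cis t)))\<^sup>2)) =
       complex_of_real (integral {0..2 * pi} (\<lambda>t. (norm (poly r (cis t)))\<^sup>2))"
    by (intro integral_unique has_integral_of_real integrable_integral integrable_continuous_real
        continuous_on_power continuous_on_norm continuous_on_poly continuous_on_cis continuous_on_id)
  ultimately have "integral {0..2 * pi} (\<lambda>t. (norm (poly r (cis t)))\<^sup>2) = 0" by simp
  then have "r = 0" by (rule poly_eq_0_integral)
  then show "q = p" by (simp add: r_def)
qed

text \<open>A lower-triangular Toeplitz matrix acts as multiplication by the polynomial with the given
  coefficients, followed by truncation after degree \<open>n\<close>.\<close>

lemma coeff_mat_op_lower_toeplitz:
  "coeff (mat_op n (lower_toeplitz n m) p) i = (if i \<le> n then \<Sum>j\<le>i. m (i - j) * coeff p j else 0)"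
proof -
  have "coeff (mat_op n (lower_toeplitz n m) p) i =
      (if i \<le> n then \<Sum>j\<le>n. lower_toeplitz n m $$ (i, j) * coeff p j else 0)"
    unfolding mat_op_def by (simp add: coeff_sum sum.delta)
  also have "(\<Sum>j\<le>n. lower_toeplitz n m $$ (i, j) * coeff p j) = (\<Sum>j\<le>i. m (i - j) * coeff p j)"
    if "i \<le> n"
    by (rule sum.mono_neutral_cong_right) (use that in \<open>auto simp: lower_toeplitz_def\<close>)
  ultimately show ?thesis by simp
qed

lemma mat_op_in_polys: "mat_op n M p \<in> polys n"
  unfolding mat_op_def polys_def
  by (auto intro!: degree_sum_le degree_monom_le[THEN order_trans])

lemma toeplitz_congruence:
  assumes AB: "\<forall>j\<le>n. coeff (A * (\<Sum>i\<le>n. Polynomial.monom (m i) i)) j = coeff B j"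
  shows "Polynomial.monom 1 (n + 1) dvd B * p - A * mat_op n (lower_toeplitz n m) p"
proof -
  let ?T = "\<Sum>i\<le>n. Polynomial.monom (m i) i" and ?X = "Polynomial.monom (1::complex) (n + 1)"
  have T: "coeff ?T i = m i" if "i \<le> n" for i using that by (simp add: coeff_sum sum.delta)
  have "?X dvd B - A * ?T"
    unfolding monom_1_dvd_iff' coeff_diff
  proof (intro allI impI)
    fix k assume "k < n + 1"
    then have "k \<le> n" by simp
    with AB have "coeff (A * ?T) k = coeff B k" by (simp only:)
    then show "coeff B k - coeff (A * ?T) k = 0" by (simp only: diff_self)
  qed
  then have 1: "?X dvd (B - A * ?T) * p" by simp
  have "?X dvd ?T * p - mat_op n (lower_toeplitz n m) p"
    unfolding monom_1_dvd_iff'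
  proof (intro allI impI)
    fix k assume k: "k < n + 1"
    have "coeff (p * ?T) k = (\<Sum>j\<le>k. m (k - j) * coeff p j)"
      unfolding coeff_mult using k by (intro sum.cong) (simp_all add: T)
    then show "coeff (?T * p - mat_op n (lower_toeplitz n m) p) k = 0"
      using k by (simp add: coeff_mat_op_lower_toeplitz mult.commute[of p])
  qed
  then have 2: "?X dvd A * (?T * p - mat_op n (lower_toeplitz n m) p)" by simp
  from dvd_add[OF 1 2] show ?thesis by (simp add: algebra_simps)
qed

text \<open>On the circle \<open>z ^ n * cnj (poly r z)\<close> is a polynomial in \<open>z\<close>, so one factor \<open>z\<close> is left over and
  the mean value of the integrand, its value at 0, vanishes.\<close>

lemma circle_inner_shifted:
  assumes A: "\<And>z. norm z \<le> 1 \<Longrightarrow> poly A z \<noteq> 0" and r: "r \<in> polys n"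
  shows "circle_inner (\<lambda>z. z ^ (n + 1) * poly G z / poly A z) (poly r) = 0"
proof -
  define s where "s = (\<Sum>i\<le>n. Polynomial.monom (cnj (coeff r i)) (n - i))"
  have s: "z ^ n * cnj (poly r z) = poly s z" if "norm z = 1" for z
  proof -
    have z: "z * cnj z = 1" using that by (simp add: complex_norm_square[symmetric])
    have "z ^ n * cnj z ^ i = z ^ (n - i)" if "i \<le> n" for i
    proof -
      have "z ^ n = z ^ (n - i) * z ^ i" using that by (simp flip: power_add)
      then show ?thesis using z by (simp add: mult.assoc flip: power_mult_distrib)
    qed
    moreover have "poly r z = (\<Sum>i\<le>n. coeff r i * z ^ i)"
      using r unfolding poly_altdef by (intro sum.mono_neutral_left) (auto simp: polys_def coeff_eq_0)
    ultimately show ?thesis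
      by (auto simp: s_def poly_sum poly_monom sum_distrib_left mult_ac intro!: sum.cong)
  qed
  define F where "F z = z * poly s z * poly G z / poly A z" for z
  have "((\<lambda>t. F (cis t)) has_integral 2 * pi * F 0) {0..2 * pi}"
    unfolding F_def
    by (rule circle_mean_value; intro continuous_intros holomorphic_intros) (use A in auto)
  then have "((\<lambda>t. F (cis t)) has_integral 0) {0..2 * pi}" by (simp add: F_def)
  moreover have "F (cis t) = cis t ^ (n + 1) * poly G (cis t) / poly A (cis t) * cnj (poly r (cis t))" for t
    unfolding F_def s[of "cis t", simplified, symmetric] by simp
  ultimately show ?thesis by (simp add: circle_inner_def integral_unique)
qed

section \<open>Taylor coefficients of the truncated symbol\<close>

text \<open>Congruence modulo \<open>X ^ (n + 1)\<close>.\<close>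

definition fps_agree :: "nat \<Rightarrow> complex fps \<Rightarrow> complex fps \<Rightarrow> bool" where
  "fps_agree n F G \<longleftrightarrow> (\<forall>k\<le>n. fps_nth F k = fps_nth G k)"

lemma fps_agree_mult:
  "fps_agree n F F' \<Longrightarrow> fps_agree n G G' \<Longrightarrow> fps_agree n (F * G) (F' * G')"
  unfolding fps_agree_def fps_mult_nth by (auto intro!: sum.cong)

lemma fps_agree_compose:
  assumes "fps_agree n G G'"
  shows "fps_agree n (F oo G) (F oo G')"
proof -
  have "fps_agree n (G ^ i) (G' ^ i)" for i
    by (induction i) (auto simp: fps_agree_mult assms, simp add: fps_agree_def)
  then show ?thesis
    unfolding fps_agree_def fps_compose_nth by (auto intro!: sum.cong)
qed

lemma poly_has_fps_expansion: "poly p has_fps_expansion fps_of_poly p" for p :: "complex poly"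
proof -
  have "(\<lambda>z. \<Sum>i\<le>degree p. coeff p i * z ^ i) has_fps_expansion
      (\<Sum>i\<le>degree p. fps_const (coeff p i) * fps_X ^ i)"
    by (intro fps_expansion_intros)
  moreover have "(\<Sum>i\<le>degree p. fps_const (coeff p i) * fps_X ^ i) = fps_of_poly p"
    by (rule fps_ext) (auto simp: fps_sum_nth fps_X_power_nth coeff_eq_0 if_distrib sum.delta' cong: if_cong)
  moreover have "poly p = (\<lambda>z. \<Sum>i\<le>degree p. coeff p i * z ^ i)"
    by (simp add: poly_altdef fun_eq_iff)
  ultimately show ?thesis by simp
qed

lemma power_series_has_fps_expansion:
  fixes a :: "nat \<Rightarrow> complex"
  assumes "summable (\<lambda>k. a k * z ^ k)" "z \<noteq> 0"
  shows "(\<lambda>w. \<Sum>k. a k * w ^ k) has_fps_expansion Abs_fps a"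
proof -
  have "fps_conv_radius (Abs_fps a) \<ge> norm z"
    unfolding fps_conv_radius_def using conv_radius_geI[OF assms(1)] by simp
  then have "fps_conv_radius (Abs_fps a) > 0"
    using assms(2) by (meson less_le_trans zero_less_norm_iff ereal_less(2))
  from eval_fps_has_fps_expansion[OF this] show ?thesis
    by (simp add: eval_fps_def[abs_def])
qed

text \<open>Let \<open>T\<close> and \<open>T'\<close> be the power series of \<open>exp (2 * pi * \<i> * h)\<close> for the full and for the truncated
  exponent; they are congruent modulo \<open>X ^ (n + 1)\<close>.  The series \<open>F\<close> of the truncated symbol
  satisfies \<open>(1 - \<i> * T') * F = - \<i> * T' - 1\<close>.  Multiplying by \<open>P\<close> and replacing \<open>T'\<close> by \<open>T\<close>, for which
  \<open>P * T = Q\<close>, gives the congruence.\<close>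

lemma taylor_congruence:
  fixes c m :: "nat \<Rightarrow> complex"
  assumes sm: "\<And>z. norm z < 1 \<Longrightarrow> summable (\<lambda>k. c k * z ^ k)"
    and exp: "\<And>z. norm z < 1 \<Longrightarrow> exp (2 * pi * \<i> * (c 0 / 2 + (\<Sum>k. c (Suc k) * z ^ Suc k))) * poly P z = poly Q z"
    and nz: "poly P 0 - \<i> * poly Q 0 \<noteq> 0" "poly P 0 \<noteq> 0"
    and c': "\<And>k. k \<le> n \<Longrightarrow> c' k = c k"
    and m: "\<And>j. j \<le> n \<Longrightarrow> m j = (deriv ^^ j) (\<lambda>z. phi (c' 0 / 2 + (\<Sum>k=1..n. c' k * z ^ k))) 0 / fact j"
    and j: "j \<le> n"
  shows "coeff ((P - Polynomial.smult \<i> Q) * (\<Sum>i\<le>n. Polynomial.monom (m i) i)) j = coeff (- (P + Polynomial.smult \<i> Q)) j"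
proof -
  define e where "e = exp (2 * complex_of_real pi * \<i> * (c 0 / 2))"
  define S where "S = Abs_fps (\<lambda>k. if k = 0 then 0 else c k)"
  define S' where "S' = Abs_fps (\<lambda>k. if k = 0 \<or> k > n then 0 else c k)"
  define T where "T = fps_const e * (fps_exp (2 * pi * \<i>) oo S)"
  define T' where "T' = fps_const e * (fps_exp (2 * pi * \<i>) oo S')"
  have ser: "(\<Sum>k. (if k = 0 then 0 else c k) * z ^ k) = (\<Sum>k. c (Suc k) * z ^ Suc k)"
    "summable (\<lambda>k. (if k = 0 then 0 else c k) * z ^ k)" if "norm z < 1" for z
  proof -
    have 1: "summable (\<lambda>k. c (Suc k) * z ^ Suc k)"
      using sm[OF that] by (subst summable_Suc_iff)
    then show 2: "summable (\<lambda>k. (if k = 0 then 0 else c k) * z ^ k)"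
      by (subst summable_Suc_iff[symmetric]) simp
    show "(\<Sum>k. (if k = 0 then 0 else c k) * z ^ k) = (\<Sum>k. c (Suc k) * z ^ Suc k)"
      using suminf_split_head[OF 2] by simp
  qed
  let ?c = "2 * complex_of_real pi * \<i>"
  let ?s = "\<lambda>w. \<Sum>k. (if k = 0 then 0 else c k) * w ^ k" and ?s' = "\<lambda>w. \<Sum>k=1..n. c' k * w ^ k"
  let ?E = "\<lambda>w. e * exp (?c * ?s w)" and ?E' = "\<lambda>w. e * exp (?c * ?s' w)"
  have exps: "(\<lambda>w. e * exp (?c * f w)) has_fps_expansion (fps_const e * (fps_exp ?c oo F))"
    if "f has_fps_expansion F" "fps_nth F 0 = 0" for f F
    using has_fps_expansion_compose[OF has_fps_expansion_exp[of ?c] that]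
    by (intro has_fps_expansion_mult has_fps_expansion_const) (simp_all add: o_def)
  have "?s has_fps_expansion S"
    unfolding S_def by (rule power_series_has_fps_expansion[OF ser(2), of "1/2"]) auto
  from exps[OF this] have T: "?E has_fps_expansion T" by (simp add: T_def S_def)
  have "?s' has_fps_expansion (\<Sum>k=1..n. fps_const (c' k) * fps_X ^ k)"
    by (intro fps_expansion_intros)
  moreover have "(\<Sum>k=1..n. fps_const (c' k) * fps_X ^ k) = S'"
    by (rule fps_ext) (auto simp: S'_def fps_sum_nth fps_X_power_nth c' if_distrib sum.delta' cong: if_cong)
  ultimately have "?s' has_fps_expansion S'" by simp
  from exps[OF this] have T': "?E' has_fps_expansion T'" by (simp add: T'_def S'_def)
  have "fps_agree n S S'" by (auto simp: fps_agree_def S_def S'_def)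
  then have TT': "fps_agree n T T'"
    unfolding T_def T'_def by (intro fps_agree_mult fps_agree_compose) (simp_all add: fps_agree_def)

  have ev: "eventually (\<lambda>z::complex. norm z < 1) (nhds 0)"
    using eventually_nhds_in_open[of "ball 0 1" "0::complex"] by simp
  have "(\<lambda>w. ?E w * poly P w) has_fps_expansion T * fps_of_poly P"
    by (intro has_fps_expansion_mult T poly_has_fps_expansion)
  moreover have ev': "eventually (\<lambda>w. ?E w * poly P w = poly Q w) (nhds 0)"
    using ev
  proof eventually_elim
    case (elim w)
    then show ?case
      using exp[OF elim] ser(1)[OF elim] by (simp add: e_def exp_add[symmetric] distrib_left)
  qed
  ultimately have "poly Q has_fps_expansion T * fps_of_poly P"
    using has_fps_expansion_cong[OF ev' refl] by (simp only:)
  then have Q: "fps_of_poly Q = T * fps_of_poly P"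
    by (rule fps_expansion_unique_complex[OF poly_has_fps_expansion])

  define F where "F = (- (fps_const \<i> * T') - 1) / (1 - fps_const \<i> * T')"
  have T0: "fps_nth T 0 = e" "fps_nth T' 0 = e" by (simp_all add: T_def T'_def)
  have "poly Q 0 = e * poly P 0"
    using arg_cong[OF Q, of "\<lambda>F. fps_nth F 0"] T0 by (simp add: poly_0_coeff_0)
  then have "1 - \<i> * e \<noteq> 0"
    using nz by (auto simp: algebra_simps)
  then have u: "fps_nth (1 - fps_const \<i> * T') 0 \<noteq> 0" using T0 by simp
  have "(\<lambda>w. (- (\<i> * ?E' w) - 1) / (1 - \<i> * ?E' w)) has_fps_expansion F"
    unfolding F_def using u by (intro has_fps_expansion_divide' fps_expansion_intros T') auto
  moreover have "(- (\<i> * ?E' w) - 1) / (1 - \<i> * ?E' w) = phi (c' 0 / 2 + ?s' w)" for w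
  proof -
    have half: "exp (\<i> * complex_of_real (pi / 2)) = \<i>"
      using cis_pi_half by (simp only: cis_conv_exp)
    have "?c * (c' 0 / 2 + ?s' w - 1 / 4) = ?c * (c 0 / 2) + ?c * ?s' w - \<i> * complex_of_real (pi / 2)"
      by (simp add: c' algebra_simps)
    then have "exp (?c * (c' 0 / 2 + ?s' w - 1 / 4)) = e * exp (?c * ?s' w) / \<i>"
      by (simp only: exp_diff exp_add e_def half)
    also have "\<dots> = - (\<i> * ?E' w)"
      by (simp only: divide_i minus_mult_left)
    finally have "exp (?c * (c' 0 / 2 + ?s' w - 1 / 4)) = - (\<i> * ?E' w)" .
    then show ?thesis unfolding phi_def by (simp only: of_real_mult of_real_numeral add.commute[of _ 1] add_uminus_conv_diff)
  qed
  ultimately have phiF: "(\<lambda>z. phi (c' 0 / 2 + ?s' z)) has_fps_expansion F" by (simp only:)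
  have F: "fps_nth F k = m k" if "k \<le> n" for k
    by (simp only: fps_nth_fps_expansion[OF phiF] m[OF that])
  have F': "(1 - fps_const \<i> * T') * F = - (fps_const \<i> * T') - 1"
  proof -
    have "U * (N * inverse U) = N * (inverse U * U)" for U N :: "complex fps"
      by (simp only: mult_ac)
    then show ?thesis
      unfolding F_def by (simp only: fps_divide_unit[OF u] inverse_mult_eq_1[OF u] mult_1_right)
  qed

  let ?P = "fps_of_poly P" and ?A = "P - Polynomial.smult \<i> Q" and ?B = "- (P + Polynomial.smult \<i> Q)"
  have A: "fps_of_poly ?A = ?P * (1 - fps_const \<i> * T)"
    by (simp add: fps_of_poly_diff fps_of_poly_smult Q algebra_simps)
  have B: "fps_of_poly ?B = ?P * (- (fps_const \<i> * T) - 1)"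
    by (simp add: fps_of_poly_diff fps_of_poly_add fps_of_poly_uminus fps_of_poly_smult Q algebra_simps)
  have ag: "fps_agree n (1 - fps_const \<i> * T) (1 - fps_const \<i> * T')"
    "fps_agree n (- (fps_const \<i> * T) - 1) (- (fps_const \<i> * T') - 1)"
    using TT' by (auto simp: fps_agree_def)
  have "fps_agree n (fps_of_poly (\<Sum>i\<le>n. Polynomial.monom (m i) i)) F"
    by (auto simp: fps_agree_def F coeff_sum sum.delta)
  then have "fps_agree n (fps_of_poly (?A * (\<Sum>i\<le>n. Polynomial.monom (m i) i))) (?P * (1 - fps_const \<i> * T') * F)"
    unfolding fps_of_poly_mult A using ag(1) by (intro fps_agree_mult) (auto simp: fps_agree_def)
  moreover have "?P * (1 - fps_const \<i> * T') * F = ?P * (- (fps_const \<i> * T') - 1)"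
    by (simp only: mult.assoc F')
  moreover have "fps_agree n (fps_of_poly ?B) (?P * (- (fps_const \<i> * T') - 1))"
    unfolding B using ag(2) by (intro fps_agree_mult) (auto simp: fps_agree_def)
  ultimately have "fps_nth (fps_of_poly (?A * (\<Sum>i\<le>n. Polynomial.monom (m i) i))) j = fps_nth (fps_of_poly ?B) j"
    using j by (simp only: fps_agree_def)
  then show ?thesis by (simp only: fps_of_poly_nth)
qed

section \<open>Norm-attaining polynomials\<close>

lemma poly_norm_eq_iff:
  "poly_norm p = poly_norm q \<longleftrightarrow>
   integral {0..2*pi} (\<lambda>t. (norm (poly p (cis t)))\<^sup>2) = integral {0..2*pi} (\<lambda>t. (norm (poly q (cis t)))\<^sup>2)"
  unfolding poly_norm_def by simp

text \<open>The error \<open>B / A * p - M p\<close> is \<open>z ^ (n + 1)\<close> times a function holomorphic near the closed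
  disc, hence orthogonal to \<open>polys n\<close>.  Because \<open>B / A\<close> is unimodular on the circle,
  \<open>\<parallel>q\<parallel>\<^sup>2 = \<parallel>M q\<parallel>\<^sup>2 + \<parallel>e\<parallel>\<^sup>2\<close> with \<open>e\<close> the error for \<open>q\<close>, so equality of norms means \<open>e = 0\<close>.\<close>

lemma toeplitz_main:
  assumes pair: "blaschke_pair N A B"
    and AB: "\<forall>j\<le>n. coeff (A * (\<Sum>i\<le>n. Polynomial.monom (m i) i)) j = coeff B j"
  defines "M \<equiv> lower_toeplitz n m"
  shows mat_op_eq_toeplitz_op: "p \<in> polys n \<Longrightarrow> mat_op n M p = toeplitz_op n (\<lambda>z. poly B z / poly A z) p"
    and norm_attaining_iff: "norm_attaining n M q \<longleftrightarrow> q \<in> polys n \<and> q \<noteq> 0 \<and> B * q = A * mat_op n M q"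
proof -
  have A: "poly A z \<noteq> 0" if "norm z \<le> 1" for z
    using blaschke_pair_nonzero(1)[OF pair that] .
  have decomp: "\<exists>G. B * p - A * mat_op n M p = Polynomial.monom 1 (n + 1) * G" for p
    using toeplitz_congruence[of n A m B p, OF AB] unfolding M_def dvd_def by blast
  have err: "poly B z / poly A z * poly p z - poly (mat_op n M p) z = z ^ (n + 1) * poly G z / poly A z"
    if "B * p - A * mat_op n M p = Polynomial.monom 1 (n + 1) * G" "norm z = 1" for p G z
  proof -
    have "poly B z * poly p z - poly A z * poly (mat_op n M p) z = z ^ (n + 1) * poly G z"
      using arg_cong[OF that(1), of "\<lambda>p. poly p z"] by (simp only: poly_diff poly_mult poly_monom mult_1)
    moreover have "x / a * y - w = (x * y - a * w) / a" if "a \<noteq> 0" for x y w a :: complex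
      using that by (simp add: diff_divide_distrib)
    ultimately show ?thesis using A[of z] that(2) by simp
  qed
  have orth: "circle_inner (\<lambda>z. poly B z / poly A z * poly p z - poly (mat_op n M p) z) (poly r) = 0"
    if r: "r \<in> polys n" for p r
  proof -
    obtain G where G: "B * p - A * mat_op n M p = Polynomial.monom 1 (n + 1) * G" using decomp by blast
    have "circle_inner (\<lambda>z. poly B z / poly A z * poly p z - poly (mat_op n M p) z) (poly r) =
        circle_inner (\<lambda>z. z ^ (n + 1) * poly G z / poly A z) (poly r)"
      unfolding circle_inner_def by (simp only: err[OF G norm_cis])
    then show ?thesis using circle_inner_shifted[OF A r] by simp
  qed
  have cont: "continuous_on unit_circle (\<lambda>z. poly B z / poly A z * poly p z)" for p
    by (intro continuous_on_mult continuous_on_divide continuous_on_poly continuous_on_id) (use A in auto)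
  show "mat_op n M p = toeplitz_op n (\<lambda>z. poly B z / poly A z) p" if "p \<in> polys n"
    unfolding toeplitz_op_def by (rule orth_proj_eqI[OF mat_op_in_polys cont orth, symmetric])
  have norm_eq: "poly_norm (mat_op n M q) = poly_norm q \<longleftrightarrow> B * q = A * mat_op n M q" for q
  proof -
    define p where "p = mat_op n M q"
    define e where "e z = poly B z / poly A z * poly q z - poly p z" for z
    have cont_cis: "continuous_on {0..2 * pi} (\<lambda>t. poly s (cis t))" for s :: "complex poly"
      by (intro continuous_on_poly continuous_on_cis continuous_on_id)
    have cont_e: "continuous_on {0..2 * pi} (\<lambda>t. e (cis t))"
      unfolding e_def by (intro continuous_on_diff continuous_on_cis_comp[OF cont] cont_cis)
    have "circle_inner e (poly p) = 0"
      unfolding e_def p_def by (rule orth[OF mat_op_in_polys])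
    then have "integral {0..2 * pi} (\<lambda>t. e (cis t) * cnj (poly p (cis t))) = 0"
      by (simp add: circle_inner_def)
    moreover have "(\<lambda>t. e (cis t) * cnj (poly p (cis t))) integrable_on {0..2 * pi}"
      by (intro integrable_continuous_real continuous_on_mult continuous_on_cnj cont_e cont_cis)
    ultimately have "((\<lambda>t. e (cis t) * cnj (poly p (cis t))) has_integral 0) {0..2 * pi}"
      by (simp add: has_integral_iff)
    from has_integral_mult_right[OF has_integral_Re[OF this], of 2]
    have cross: "((\<lambda>t. 2 * Re (e (cis t) * cnj (poly p (cis t)))) has_integral 0) {0..2 * pi}" by simp
    have sq: "((\<lambda>t. (norm (f t))\<^sup>2) has_integral integral {0..2 * pi} (\<lambda>t. (norm (f t))\<^sup>2)) {0..2 * pi}"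
      if "continuous_on {0..2 * pi} f" for f :: "real \<Rightarrow> complex"
      by (intro integrable_integral integrable_continuous_real continuous_on_power continuous_on_norm that)
    have pyth: "(norm (poly p z))\<^sup>2 + (norm (e z))\<^sup>2 + 2 * Re (e z * cnj (poly p z)) = (norm (poly q z))\<^sup>2"
      if z: "norm z = 1" for z
    proof -
      have "norm (poly B z / poly A z) = 1"
        using A[of z] blaschke_pair_norm_circle[OF pair z] z by (simp add: norm_divide)
      then have "norm (poly B z / poly A z * poly q z) = norm (poly q z)"
        by (simp only: norm_mult mult_1_left)
      moreover have "poly B z / poly A z * poly q z = poly p z + e z"
        by (simp add: e_def)
      ultimately have "norm (poly q z) = norm (poly p z + e z)" by (simp only:)
      moreover have "(norm a)\<^sup>2 + (norm b)\<^sup>2 + 2 * Re (b * cnj a) = (norm (a + b))\<^sup>2" for a b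
        unfolding cmod_power2 by (simp add: power2_eq_square algebra_simps)
      ultimately show ?thesis by (simp only:)
    qed
    have "((\<lambda>t. (norm (poly q (cis t)))\<^sup>2) has_integral
        integral {0..2 * pi} (\<lambda>t. (norm (poly p (cis t)))\<^sup>2) + integral {0..2 * pi} (\<lambda>t. (norm (e (cis t)))\<^sup>2) + 0) {0..2 * pi}"
      using has_integral_add[OF has_integral_add[OF sq[OF cont_cis[of p]] sq[OF cont_e]] cross]
      by (simp only: pyth[OF norm_cis])
    then have "poly_norm p = poly_norm q \<longleftrightarrow> integral {0..2 * pi} (\<lambda>t. (norm (e (cis t)))\<^sup>2) = 0"
      unfolding poly_norm_eq_iff by (auto dest!: integral_unique)
    also have "\<dots> \<longleftrightarrow> B * q = A * p"
    proof
      assume *: "integral {0..2 * pi} (\<lambda>t. (norm (e (cis t)))\<^sup>2) = 0"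
      have "B * q - A * p = 0"
      proof (rule poly_eq_0_on_circle)
        fix t :: real assume t: "0 \<le> t" "t \<le> 2 * pi"
        have "e (cis t) = 0"
          using integral_norm_square_eq_0[OF cont_e _ *] t by simp
        then show "poly (B * q - A * p) (cis t) = 0"
          using A[of "cis t"] by (simp add: e_def field_simps)
      qed
      then show "B * q = A * p" by simp
    next
      assume eq: "B * q = A * p"
      have "poly B z * poly q z = poly A z * poly p z" for z
        using arg_cong[OF eq, of "\<lambda>s. poly s z"] by (simp only: poly_mult)
      then have "e (cis t) = 0" for t
        using A[of "cis t"] by (simp add: e_def field_simps)
      then show "integral {0..2 * pi} (\<lambda>t. (norm (e (cis t)))\<^sup>2) = 0" by simp
    qed
    finally show ?thesis unfolding p_def .
  qed
  show "norm_attaining n M q \<longleftrightarrow> q \<in> polys n \<and> q \<noteq> 0 \<and> B * q = A * mat_op n M q"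
    unfolding norm_attaining_def norm_eq ..
qed

text \<open>For \<open>q = A\<close> the polynomial \<open>B - M A\<close> has degree at most \<open>n\<close> and is divisible by \<open>z ^ (n + 1)\<close>,
  so it is 0.  Conversely \<open>A\<close> divides \<open>B * q\<close> and is coprime to \<open>B\<close>.\<close>

lemma norm_attaining_multiples:
  assumes pair: "blaschke_pair N A B" and N: "N \<le> n"
    and AB: "\<forall>j\<le>n. coeff (A * (\<Sum>i\<le>n. Polynomial.monom (m i) i)) j = coeff B j"
  defines "M \<equiv> lower_toeplitz n m"
  shows "norm_attaining n M A"
    and "norm_attaining n M q \<Longrightarrow> \<exists>r. q = A * r \<and> mat_op n M q = B * r"
proof -
  have "A \<noteq> 0" using blaschke_pair_nonzero(1)[OF pair, of 0] by auto
  note iff = norm_attaining_iff[OF pair AB, folded M_def]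
  show "norm_attaining n M A"
  proof -
    have "Polynomial.monom 1 (n + 1) dvd A * (B - mat_op n M A)"
      using toeplitz_congruence[OF AB, of A] by (simp add: M_def algebra_simps)
    moreover have "poly A 0 \<noteq> 0" using blaschke_pair_nonzero(1)[OF pair, of 0] by auto
    then have "coprime (Polynomial.monom 1 (n + 1)) A"
      by (intro coprime_poly_no_common_root) (auto simp: poly_monom)
    ultimately have dvd: "Polynomial.monom 1 (n + 1) dvd B - mat_op n M A"
      by (simp only: coprime_dvd_mult_right_iff)
    have "degree (B - mat_op n M A) \<le> n"
      using blaschke_pair_degree(2)[OF pair] N mat_op_in_polys[of n M A]
      by (intro degree_diff_le) (simp_all add: polys_def)
    then have "B - mat_op n M A = 0"
      using dvd_imp_degree_le[OF dvd] degree_monom_eq[of "1::complex" "n + 1"] by fastforce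
    then show ?thesis
      using \<open>A \<noteq> 0\<close> N blaschke_pair_degree(1)[OF pair] by (simp add: iff polys_def mult.commute)
  qed
  assume "norm_attaining n M q"
  then have eq: "B * q = A * mat_op n M q" using iff by blast
  then have "A dvd B * q" by (metis dvd_triv_left)
  then have "A dvd q"
    using blaschke_pair_coprime[OF pair] coprime_dvd_mult_right_iff by blast
  then obtain r where r: "q = A * r" by blast
  then have "A * mat_op n M q = A * (B * r)" using eq by (simp only: mult_ac)
  then have "mat_op n M q = B * r" using \<open>A \<noteq> 0\<close> by (metis mult_cancel_left)
  then show "\<exists>r. q = A * r \<and> mat_op n M q = B * r" using r by blast
qed

section \<open>The Blaschke product of a union of arcs\<close>

lemma conj_reflection_prod:
  assumes "\<And>i. i \<in> I \<Longrightarrow> conj_reflection 1 (f i) (g i)"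
  shows "conj_reflection (card I) (\<Prod>i\<in>I. f i) (\<Prod>i\<in>I. g i)"
  using assms unfolding conj_reflection_def by (simp add: poly_prod prod.distrib)

text \<open>The constant \<open>cis ((t - s) / 2)\<close> is chosen so that the factor of self-reflection depends on \<open>s\<close>
  only.  Therefore \<open>P\<close> (the case \<open>t = s\<close>) and \<open>Q\<close> get the same factor, which amounts to \<open>Q / P\<close> being
  real on the circle.\<close>

lemma conj_reflection_linear:
  "conj_reflection 1 (Polynomial.smult (cis ((t - s) / 2)) [:1, - cis (- t):])
     (Polynomial.smult (- cis s) (Polynomial.smult (cis ((t - s) / 2)) [:1, - cis (- t):]))"
proof -
  have "cis s * cis ((t - s) / 2) = cis ((s - t) / 2) * cis t" "cis s * cis ((t - s) / 2) * cis (- t) = cis ((s - t) / 2)"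
    unfolding cis_mult by (rule arg_cong[of _ _ cis], simp add: field_simps)+
  moreover have "cnj (cis ((t - s) / 2)) = cis ((s - t) / 2)"
    unfolding cis_cnj[symmetric] by (simp add: cis_cnj minus_divide_left)
  ultimately show ?thesis
    unfolding conj_reflection_def by (simp add: cis_cnj algebra_simps)
qed

lemma conj_reflection_linear_comb:
  "conj_reflection N p p' \<Longrightarrow> conj_reflection N q q' \<Longrightarrow>
   conj_reflection N (p - Polynomial.smult a q) (p' - Polynomial.smult (cnj a) q')"
  unfolding conj_reflection_def by (simp add: algebra_simps)

text \<open>Inside the disc \<open>A = P * (X + 1)\<close>, where \<open>X = exp (2 * pi * \<i> * (h - 1/4))\<close> has nonnegative
  real part.  On the circle a zero of \<open>A\<close> is by reflection a zero of \<open>B\<close>, hence a common zero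
  of \<open>P\<close> and \<open>Q\<close>.  The third claim concerns the only case in which the degree of \<open>A\<close> drops.\<close>

lemma blaschke_pair_of_exp_quotient:
  assumes h': "\<forall>z. norm z < 1 \<longrightarrow> 0 \<le> Re (h z) \<and> Re (h z) \<le> 1 / 2"
    and exp': "\<forall>z. norm z < 1 \<longrightarrow> exp (2 * pi * \<i> * h z) * poly P z = poly Q z"
    and ncr: "\<forall>z. poly P z \<noteq> 0 \<or> poly Q z \<noteq> 0"
    and deg: "degree P \<le> N" "degree Q \<le> N"
    and refl: "conj_reflection N P (Polynomial.smult w P)" "conj_reflection N Q (Polynomial.smult w Q)"
    and w: "norm w = 1"
  defines "A \<equiv> P - Polynomial.smult \<i> Q" and "B \<equiv> - (P + Polynomial.smult \<i> Q)"
  shows "blaschke_pair N A B" and "norm z < 1 \<Longrightarrow> poly B z / poly A z = phi (h z)"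
    and "poly B 0 = 0 \<Longrightarrow> h 0 = 1 / 4" and "poly A 0 \<noteq> 0" and "poly P 0 \<noteq> 0"
proof -
  have h: "0 \<le> Re (h z) \<and> Re (h z) \<le> 1 / 2" if "norm z < 1" for z
    using h' that by simp
  have exp: "exp (2 * pi * \<i> * h z) * poly P z = poly Q z" if "norm z < 1" for z
    using exp' that by simp
  define X where "X z = exp (2 * pi * \<i> * (h z - 1 / 4))" for z
  have X: "exp (2 * pi * \<i> * h z) = \<i> * X z" for z
  proof -
    have "2 * pi * \<i> * h z = \<i> * complex_of_real (pi / 2) + 2 * pi * \<i> * (h z - 1 / 4)"
      by (simp add: algebra_simps)
    then have "exp (2 * pi * \<i> * h z) = cis (pi / 2) * X z"
      by (simp only: exp_add X_def cis_conv_exp)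
    then show ?thesis by simp
  qed
  have Q: "poly Q z = \<i> * X z * poly P z" if "norm z < 1" for z
    using exp[OF that] unfolding X by simp
  have P: "poly P z \<noteq> 0" if "norm z < 1" for z
    using Q[OF that] ncr[rule_format, of z] by auto
  have X1: "X z + 1 \<noteq> 0" if "norm z < 1" for z
  proof -
    have "cos (2 * pi * (Re (h z) - 1 / 4)) \<ge> 0"
    proof (rule cos_ge_zero)
      have "pi * 0 \<le> pi * Re (h z)" "pi * Re (h z) \<le> pi * (1 / 2)"
        using h[OF that] by (intro mult_left_mono; simp)+
      then show "- (pi / 2) \<le> 2 * pi * (Re (h z) - 1 / 4)" "2 * pi * (Re (h z) - 1 / 4) \<le> pi / 2"
        by (simp_all add: algebra_simps)
    qed
    then have "Re (X z) \<ge> 0" by (simp add: X_def Re_exp)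
    then show ?thesis by (metis add.commute add_eq_0_iff complex_Re_le_cmod neg_0_le_iff_le norm_one not_one_le_zero one_complex.simps(1) uminus_complex.simps(1))
  qed
  have Aeq: "poly A z = poly P z * (X z + 1)" and Beq: "poly B z = poly P z * (X z - 1)" if "norm z < 1" for z
    unfolding A_def B_def by (simp_all add: Q[OF that] algebra_simps flip: mult.assoc[of \<i> \<i>])
  show quot: "poly B z / poly A z = phi (h z)" if "norm z < 1" for z
    unfolding Aeq[OF that] Beq[OF that] phi_def using P[OF that] by (simp add: X_def)
  have disc: "poly A z \<noteq> 0" if "norm z < 1" for z
    using Aeq[OF that] P[OF that] X1[OF that] by simp
  show "poly A 0 \<noteq> 0" "poly P 0 \<noteq> 0" using disc[of 0] P[of 0] by auto
  have refl': "conj_reflection N A (Polynomial.smult (- w) B)"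
  proof -
    have "Polynomial.smult (- w) B = Polynomial.smult w P - Polynomial.smult (cnj \<i>) (Polynomial.smult w Q)"
      by (rule poly_eqI) (simp add: B_def algebra_simps)
    then show ?thesis using conj_reflection_linear_comb[OF refl, of \<i>] by (simp only: A_def)
  qed
  have "poly A z \<noteq> 0" if z: "norm z = 1" for z
  proof
    assume A0: "poly A z = 0"
    have "z \<noteq> 0" using z by auto
    have "z * cnj z = 1" using z by (simp add: complex_norm_square[symmetric])
    then have "1 / cnj z = z" using \<open>z \<noteq> 0\<close> by (simp add: field_simps)
    then have "w * poly B z = 0"
      using refl' \<open>z \<noteq> 0\<close> A0 unfolding conj_reflection_def by fastforce
    then have "poly B z = 0" using w by auto
    with A0 have "poly P z - \<i> * poly Q z = 0" "poly P z + \<i> * poly Q z = 0"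
      by (simp_all add: A_def B_def)
    then have "poly P z = 0" "\<i> * poly Q z = 0" by (simp_all add: complex_eq_iff)
    then show False using ncr[rule_format, of z] by auto
  qed
  with disc have "poly A z \<noteq> 0" if "norm z \<le> 1" for z
    using that by (cases "norm z = 1") auto
  moreover have "degree A \<le> N"
    unfolding A_def using deg by (intro degree_diff_le) (auto intro: order_trans[OF degree_smult_le])
  ultimately show "blaschke_pair N A B"
    using blaschke_pair_of_reflection[OF _ _ refl'] w by simp
  show "h 0 = 1 / 4" if "poly B 0 = 0"
  proof -
    have "X 0 = 1" using Beq[of 0] P[of 0] that by simp
    then have "Re (2 * pi * \<i> * (h 0 - 1 / 4)) = 0 \<and>
        (\<exists>k :: int. Im (2 * pi * \<i> * (h 0 - 1 / 4)) = of_int (2 * k) * pi)"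
      by (simp only: X_def exp_eq_1)
    then obtain k :: int where k: "Re (2 * pi * \<i> * (h 0 - 1 / 4)) = 0"
      "Im (2 * pi * \<i> * (h 0 - 1 / 4)) = of_int (2 * k) * pi"
      by (elim conjE exE)
    have "2 * pi * (Re (h 0) - 1 / 4) = 2 * pi * of_int k" using k(2) by simp
    then have "Re (h 0) - 1 / 4 = of_int k"
      by (simp only: mult_cancel_left) simp
    moreover have "Im (h 0) = 0" using k(1) by simp
    moreover have "k = 0"
    proof -
      have "- 1 < real_of_int k" "real_of_int k < 1"
        using \<open>Re (h 0) - 1 / 4 = of_int k\<close> h[of 0] by auto
      then show ?thesis by linarith
    qed
    ultimately show ?thesis by (simp add: complex_eq_iff)
  qed
qed

text \<open>The theorem for any set whose \<open>exp (2 * pi * \<i> * h_E)\<close> is a quotient \<open>Q / P\<close> of polynomials that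
  are self-reflecting with a common factor.  This covers unions of arcs as well as the full circle,
  where \<open>P = 1\<close> and \<open>Q = -1\<close>.\<close>

lemma recovery_from_quotient:
  fixes c m :: "nat \<Rightarrow> complex"
  assumes E: "circle_integrable E"
    and exp: "\<forall>z. norm z < 1 \<longrightarrow> exp (2 * pi * \<i> * h_fun E z) * poly P z = poly Q z"
    and ncr: "\<forall>z. poly P z \<noteq> 0 \<or> poly Q z \<noteq> 0"
    and deg: "degree P \<le> N" "degree Q \<le> N"
    and refl: "conj_reflection N P (Polynomial.smult w P)" "conj_reflection N Q (Polynomial.smult w Q)"
    and w: "norm w = 1" and N: "N \<le> n"
    and c: "\<forall>k\<le>n. c k = fourier_coeff E (int k)"
    and m: "\<forall>j\<le>n.
           m j = (deriv ^^ j) (\<lambda>z. phi (c 0 / 2 + (\<Sum>k=1..n. c k * z ^ k))) 0 / fact j"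
    and M: "M = lower_toeplitz n m"
  shows "blaschke_extension E (b_fun E)"
    and "\<forall>\<xi>\<in>polys n. mat_op n M \<xi> = toeplitz_op n (b_fun E) \<xi>"
    and "norm_attaining n M q \<Longrightarrow> poly q z \<noteq> 0 \<Longrightarrow> b_fun E z = poly (mat_op n M q) z / poly q z"
    and "\<exists>q. norm_attaining n M q"
    and "is_arg_min degree (norm_attaining n M) q \<Longrightarrow>
       coprime (mat_op n M q) q \<and>
       blaschke_product (max (degree q) (degree (mat_op n M q))) (b_fun E) \<and>
       (c 0 \<noteq> 1/2 \<longrightarrow> blaschke_product (degree q) (b_fun E)) \<and>
       {z. poly (mat_op n M q - q) z = 0} = {z. b_fun E z = 1} \<and>
       {z. poly (mat_op n M q + q) z = 0} = {z. b_fun E z = -1}"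
    and "{z. b_fun E z = 1} = {z. poly P z = 0}"
    and "{z. b_fun E z = -1} = {z. poly Q z = 0}"
proof -
  define A where "A = P - Polynomial.smult \<i> Q"
  define B where "B = - (P + Polynomial.smult \<i> Q)"
  have h: "\<forall>z. norm z < 1 \<longrightarrow> 0 \<le> Re (h_fun E z) \<and> Re (h_fun E z) \<le> 1 / 2"
    using Re_h_fun_bounds[OF E] by simp
  note pq = blaschke_pair_of_exp_quotient[of "h_fun E", OF h exp ncr deg refl w, folded A_def B_def]
  note pair = pq(1)
  have b: "b_fun E = (\<lambda>z. poly B z / poly A z)"
    by (rule b_fun_eqI(1)[OF pair]) (rule pq(2))
  show "blaschke_extension E (b_fun E)"
    by (rule b_fun_eqI(2)[OF pair]) (rule pq(2))
  have c0: "c 0 = fourier_coeff E 0" using c by simp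
  have AB: "\<forall>j\<le>n. coeff (A * (\<Sum>i\<le>n. Polynomial.monom (m i) i)) j = coeff B j"
  proof (intro allI impI)
    fix j assume "j \<le> n"
    show "coeff (A * (\<Sum>i\<le>n. Polynomial.monom (m i) i)) j = coeff B j"
      unfolding A_def B_def
    proof (rule taylor_congruence[where c = "\<lambda>k. fourier_coeff E (int k)" and c' = c])
      show "exp (2 * pi * \<i> * (fourier_coeff E (int 0) / 2 + (\<Sum>k. fourier_coeff E (int (Suc k)) * z ^ Suc k))) *
          poly P z = poly Q z" if "norm z < 1" for z
        using exp that by (simp add: h_fun_def)
      show "poly P 0 - \<i> * poly Q 0 \<noteq> 0" using pq(4) by (simp add: A_def)
      show "poly P 0 \<noteq> 0" by (rule pq(5))
      show "summable (\<lambda>k. fourier_coeff E (int k) * z ^ k)" if "norm z < 1" for z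
        by (rule h_fun_herglotz(1)[OF E that])
    qed (use c m \<open>j \<le> n\<close> in simp_all)
  qed
  show "\<forall>\<xi>\<in>polys n. mat_op n M \<xi> = toeplitz_op n (b_fun E) \<xi>"
    unfolding b M using mat_op_eq_toeplitz_op[OF pair AB] by blast
  note mult = norm_attaining_multiples[OF pair N AB, folded M]
  show "b_fun E z = poly (mat_op n M q) z / poly q z" if "norm_attaining n M q" "poly q z \<noteq> 0"
    using mult(2)[OF that(1)] that(2) by (auto simp: b)
  show "\<exists>q. norm_attaining n M q" using mult(1) by blast
  have A0: "A \<noteq> 0" using pq(4) by auto
  have BA: "poly B z - poly A z = - 2 * poly P z" "poly B z + poly A z = - 2 * \<i> * poly Q z" for z
    by (simp_all add: A_def B_def)
  have one: "poly B z / poly A z = 1 \<longleftrightarrow> poly B z - poly A z = 0" for z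
    using blaschke_pair_coprime[OF pair] coprime_poly_0[of A B z] by auto
  have mone: "poly B z / poly A z = - 1 \<longleftrightarrow> poly B z + poly A z = 0" for z
    using blaschke_pair_coprime[OF pair] coprime_poly_0[of A B z] by (auto simp: divide_eq_eq add_eq_0_iff)
  show "{z. b_fun E z = 1} = {z. poly P z = 0}" unfolding b one BA by simp
  show "{z. b_fun E z = - 1} = {z. poly Q z = 0}" unfolding b mone BA by simp
  assume q: "is_arg_min degree (norm_attaining n M) q"
  then have "norm_attaining n M q" and min: "degree q \<le> degree A"
    using mult(1) by (auto simp: is_arg_min_linorder)
  then obtain r where r: "q = A * r" "mat_op n M q = B * r" using mult(2) by blast
  have "q \<noteq> 0" using q by (auto simp: is_arg_min_def norm_attaining_def)
  then have "r \<noteq> 0" using r by auto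
  then have "degree r = 0" using min A0 unfolding r(1) by (simp add: degree_mult_eq)
  then obtain k where k: "r = [:k:]" using degree_eq_zeroE by blast
  have "k \<noteq> 0" using k \<open>r \<noteq> 0\<close> by auto
  have q: "q = Polynomial.smult k A" and Mq: "mat_op n M q = Polynomial.smult k B"
    using r k by simp_all
  have bp: "blaschke_product N (b_fun E)"
    unfolding b blaschke_product_iff_pair using pair by blast
  have "coprime (mat_op n M q) q"
    unfolding Mq unfolding q
    using blaschke_pair_coprime[OF pair] coprime_poly_0[of A B] \<open>k \<noteq> 0\<close>
    by (intro coprime_poly_no_common_root) auto
  moreover have "max (degree q) (degree (mat_op n M q)) = N"
    unfolding Mq unfolding q using \<open>k \<noteq> 0\<close> blaschke_pair_degree(1,2)[OF pair] by simp
  moreover have "degree q = N" if "c 0 \<noteq> 1 / 2"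
  proof -
    have "h_fun E 0 = c 0 / 2" using c0 by (simp add: h_fun_def)
    then have h0: "c 0 = 2 * h_fun E 0" by (simp add: mult.commute)
    have "poly B 0 \<noteq> 0"
    proof
      assume "poly B 0 = 0"
      from h0[unfolded pq(3)[OF this]] that show False by simp
    qed
    then show ?thesis using blaschke_pair_degree(3)[OF pair] \<open>k \<noteq> 0\<close> unfolding q by simp
  qed
  moreover have "{z. poly (mat_op n M q - q) z = 0} = {z. b_fun E z = 1}"
    unfolding b one Mq unfolding q using \<open>k \<noteq> 0\<close> by (simp flip: right_diff_distrib)
  moreover have "{z. poly (mat_op n M q + q) z = 0} = {z. b_fun E z = -1}"
    unfolding b mone Mq unfolding q using \<open>k \<noteq> 0\<close> by (simp flip: distrib_left)
  ultimately show "coprime (mat_op n M q) q \<and>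
       blaschke_product (max (degree q) (degree (mat_op n M q))) (b_fun E) \<and>
       (c 0 \<noteq> 1/2 \<longrightarrow> blaschke_product (degree q) (b_fun E)) \<and>
       {z. poly (mat_op n M q - q) z = 0} = {z. b_fun E z = 1} \<and>
       {z. poly (mat_op n M q + q) z = 0} = {z. b_fun E z = -1}"
    using bp by simp
qed

text \<open>Distinct components are disjoint and a nondegenerate arc has two different endpoints, so an
  initial point is never a final point: \<open>P\<close> and \<open>Q\<close> have no common root.\<close>

lemma arc_polynomials:
  assumes fin: "finite (components E)"
    and param: "arc_param E s t"
  defines "K \<equiv> {C \<in> components E. \<not> is_singleton C}"
  defines "P \<equiv> \<Prod>C\<in>K. [:1, - cis (- s C):]"
    and "Q \<equiv> \<Prod>C\<in>K. Polynomial.smult (cis ((t C - s C) / 2)) [:1, - cis (- t C):]"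
  shows "poly P z = 0 \<longleftrightarrow> z \<in> cis ` s ` K" and "poly Q z = 0 \<longleftrightarrow> z \<in> cis ` t ` K"
    and "\<forall>z. poly P z \<noteq> 0 \<or> poly Q z \<noteq> 0"
    and "degree P \<le> card K" and "degree Q \<le> card K"
    and "conj_reflection (card K) P (Polynomial.smult (\<Prod>C\<in>K. - cis (s C)) P)"
    and "conj_reflection (card K) Q (Polynomial.smult (\<Prod>C\<in>K. - cis (s C)) Q)"
    and "norm (\<Prod>C\<in>K. - cis (s C)) = 1"
    and "\<forall>z. norm z < 1 \<longrightarrow> exp (2 * pi * \<i> * h_fun E z) * poly P z = poly Q z"
proof -
  have finK: "finite K" using fin by (simp add: K_def)
  have zero: "1 - cis (- x) * z = 0 \<longleftrightarrow> z = cis x" for x z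
  proof -
    have "1 - cis (- x) * z = cis (- x) * (cis x - z)" by (simp add: algebra_simps cis_mult)
    then show ?thesis by auto
  qed
  have Pz: "poly P z = (\<Prod>C\<in>K. 1 - cis (- s C) * z)" for z
    by (simp add: P_def poly_prod mult.commute)
  have Qz: "poly Q z = (\<Prod>C\<in>K. cis ((t C - s C) / 2) * (1 - cis (- t C) * z))" for z
    by (simp add: Q_def poly_prod algebra_simps)
  show P0: "poly P z = 0 \<longleftrightarrow> z \<in> cis ` s ` K" for z
    unfolding Pz using finK by (auto simp only: prod_zero_iff zero)
  show Q0: "poly Q z = 0 \<longleftrightarrow> z \<in> cis ` t ` K" for z
    unfolding Qz using finK by (auto simp only: prod_zero_iff mult_eq_0_iff cis_neq_zero zero)
  show "\<forall>z. poly P z \<noteq> 0 \<or> poly Q z \<noteq> 0"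
  proof (rule ccontr)
    assume "\<not> ?thesis"
    then obtain z where "poly P z = 0" "poly Q z = 0" by auto
    then obtain C D where CD: "C \<in> K" "D \<in> K" "z = cis (s C)" "z = cis (t D)"
      using P0 Q0 by auto
    then have comp: "C \<in> components E" "D \<in> components E" by (simp_all add: K_def)
    obtain a b where C: "a = s C" "b = t C" "a \<le> b" "b < a + 2 * pi" "C = cis ` {a..b}"
      using param comp(1) unfolding arc_param_def by blast
    obtain a' b' where D: "b' = t D" "a' \<le> b'" "D = cis ` {a'..b'}"
      using param comp(2) unfolding arc_param_def by blast
    have "z \<in> C" using C(3,5) CD(3) unfolding C(1)[symmetric] by simp
    moreover have "z \<in> D" using D(2,3) CD(4) unfolding D(1)[symmetric] by simp
    ultimately have "C = D" using comp components_nonoverlap[of C E D] by blast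
    then have "cis a = cis b" using CD(3,4) C(1,2) by simp
    then have "a = b" by (rule cis_eq_cis_imp_eq[OF C(3,4)])
    then have "is_singleton C" unfolding C(5) by simp
    then show False using CD(1) by (simp add: K_def)
  qed
  have deg: "degree (\<Prod>C\<in>K. f C) \<le> card K" if "\<And>C. degree (f C) \<le> 1" for f :: "complex set \<Rightarrow> complex poly"
  proof -
    have "degree (\<Prod>C\<in>K. f C) \<le> (\<Sum>C\<in>K. degree (f C))" using degree_prod_sum_le[OF finK] by simp
    also have "\<dots> \<le> (\<Sum>C\<in>K. 1)" by (rule sum_mono) (rule that)
    finally show ?thesis by simp
  qed
  show "degree P \<le> card K" "degree Q \<le> card K"
    unfolding P_def Q_def by (rule deg; simp)+
  show "conj_reflection (card K) P (Polynomial.smult (\<Prod>C\<in>K. - cis (s C)) P)"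
    unfolding P_def prod_smult[symmetric]
    using conj_reflection_linear[of "s C" "s C" for C] by (intro conj_reflection_prod) simp
  show "conj_reflection (card K) Q (Polynomial.smult (\<Prod>C\<in>K. - cis (s C)) Q)"
    unfolding Q_def prod_smult[symmetric] by (intro conj_reflection_prod conj_reflection_linear)
  show "norm (\<Prod>C\<in>K. - cis (s C)) = 1" by (simp add: prod_norm[symmetric])
  show "\<forall>z. norm z < 1 \<longrightarrow> exp (2 * pi * \<i> * h_fun E z) * poly P z = poly Q z"
    unfolding Pz Qz K_def using exp_h_fun_components[OF fin param] by blast
qed

(* The first and the fourth conjunct (b_E exists; a norm-attaining q exists) make explicit what the
   definition of b_E and the choice of q presuppose.
   The degree of q drops below the order of b_E exactly when b_E(0) = 0, i.e. c 0 = 1/2: for a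
   half circle, b_E(z) = u * z and q is constant.
   One-point arcs are invisible to the Fourier coefficients, so their endpoints are left out. *)

theorem mainTheorem2:
  fixes n :: nat and E :: "complex set" and c m :: "nat \<Rightarrow> complex" and M :: "complex mat"
  assumes "n > 0"
    and "E \<subseteq> unit_circle"
    and "union_of_arcs n E"
    and "\<And>k. k \<le> n \<Longrightarrow> c k = fourier_coeff E (int k)"
    and "\<And>j. j \<le> n \<Longrightarrow>
           m j = (deriv ^^ j) (\<lambda>z. phi (c 0 / 2 + (\<Sum>k=1..n. c k * z ^ k))) 0 / fact j"
    and "M = lower_toeplitz n m"
  shows
    "blaschke_extension E (b_fun E) \<and>
     (\<forall>\<xi>\<in>polys n. mat_op n M \<xi> = toeplitz_op n (b_fun E) \<xi>) \<and>
     (\<forall>q. norm_attaining n M q \<longrightarrow>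
       (\<forall>z. poly q z \<noteq> 0 \<longrightarrow> b_fun E z = poly (mat_op n M q) z / poly q z)) \<and>
     (\<exists>q. norm_attaining n M q) \<and>
     (\<forall>q. is_arg_min degree (norm_attaining n M) q \<longrightarrow>
       coprime (mat_op n M q) q \<and>
       blaschke_product (max (degree q) (degree (mat_op n M q))) (b_fun E) \<and>
       (c 0 \<noteq> 1/2 \<longrightarrow> blaschke_product (degree q) (b_fun E)) \<and>
       \<Union>(endpoints ` {A \<in> arcs_of E. \<not> is_singleton A})
         = {z. b_fun E z = 1} \<union> {z. b_fun E z = -1} \<and>
       {z. poly (mat_op n M q - q) z = 0} = {z. b_fun E z = 1} \<and>
       {z. poly (mat_op n M q + q) z = 0} = {z. b_fun E z = -1})"
proof -
  have c: "\<forall>k\<le>n. c k = fourier_coeff E (int k)"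
    and m: "\<forall>j\<le>n. m j = (deriv ^^ j) (\<lambda>z. phi (c 0 / 2 + (\<Sum>k=1..n. c k * z ^ k))) 0 / fact j"
    using assms(4,5) by blast+
  show ?thesis
  proof (cases "E = unit_circle")
    case True
    have ind: "indicator E (cis x) = (1::complex)" for x by (simp add: True)
    have int: "circle_integrable E"
      unfolding circle_integrable_def ind mult_1_left
      by (meson continuous_on_subset integrable_continuous_real subset_UNIV)
    have half: "h_fun E z = 1 / 2" if z: "norm z < 1" for z
      unfolding h_fun_herglotz(2)[OF int z] ind mult_1_left integral_unique[OF integral_herglotz_circle[OF z]]
      by simp
    have ex: "\<forall>z. norm z < 1 \<longrightarrow> exp (2 * pi * \<i> * h_fun E z) * poly 1 z = poly (- 1) z"
    proof (intro allI impI)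
      fix z :: complex assume z: "norm z < 1"
      have "exp (2 * pi * \<i> * (1 / 2)) = - 1" using exp_pi_i by (simp add: mult.commute)
      then show "exp (2 * pi * \<i> * h_fun E z) * poly 1 z = poly (- 1) z"
        unfolding half[OF z] by simp
    qed
    have refl: "conj_reflection 0 1 (Polynomial.smult 1 1)" "conj_reflection 0 (- 1) (Polynomial.smult 1 (- 1))"
      by (simp_all add: conj_reflection_def)
    have ncr: "\<forall>z :: complex. poly 1 z \<noteq> 0 \<or> poly (- 1) z \<noteq> 0" by simp
    have deg: "degree (1 :: complex poly) \<le> 0" "degree (- 1 :: complex poly) \<le> 0" by simp_all
    note rec = recovery_from_quotient[OF int ex ncr deg refl norm_one le0 c m assms(6)]
    have "\<Union>(endpoints ` {A \<in> arcs_of E. \<not> is_singleton A}) = {z. b_fun E z = 1} \<union> {z. b_fun E z = -1}"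
      unfolding rec(6,7) by (simp add: arcs_of_def True)
    then show ?thesis using rec(1-5) by blast
  next
    case False
    note comps = union_of_arcs_components[OF assms(3,2) False]
    define K where "K = {C \<in> components E. \<not> is_singleton C}"
    have "card K \<le> card (components E)"
      unfolding K_def by (rule card_mono) (use comps(1) in auto)
    then have K: "card K \<le> n" using comps(2) by simp
    have recovery: "{z. b_fun E z = 1} = cis ` s ` K" "{z. b_fun E z = -1} = cis ` t ` K"
      if param: "arc_param E s t" for s t
    proof -
      note ap = arc_polynomials[OF comps(1) param, folded K_def]
      note rec = recovery_from_quotient[OF circle_integrable_components[OF comps(1) param]
          ap(9) ap(3) ap(4-8) K c m assms(6)]
      show "{z. b_fun E z = 1} = cis ` s ` K" "{z. b_fun E z = -1} = cis ` t ` K"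
        unfolding rec(6,7) ap(1,2) Collect_mem_eq by (rule refl)+
    qed
    obtain s t where st: "arc_param E s t"
    proof -
      have "\<forall>C\<in>components E. \<exists>p::real \<times> real. fst p \<le> snd p \<and> snd p < fst p + 2 * pi \<and> C = cis ` {fst p..snd p}"
        using comps(3) by simp
      from bchoice[OF this] obtain f :: "complex set \<Rightarrow> real \<times> real" where
        "\<forall>C\<in>components E. fst (f C) \<le> snd (f C) \<and> snd (f C) < fst (f C) + 2 * pi \<and> C = cis ` {fst (f C)..snd (f C)}" ..
      then show ?thesis using that[of "fst \<circ> f" "snd \<circ> f"] by (simp add: arc_param_def)
    qed
    have "\<Union>(endpoints ` K) = {z. b_fun E z = 1} \<union> {z. b_fun E z = -1}"
    proof
      show "\<Union>(endpoints ` K) \<subseteq> {z. b_fun E z = 1} \<union> {z. b_fun E z = -1}"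
      proof
        fix z assume "z \<in> \<Union>(endpoints ` K)"
        then obtain C s' t' where C: "C \<in> K" "s' \<le> t'" "t' < s' + 2 * pi" "C = cis ` {s'..t'}" "z = cis s' \<or> z = cis t'"
          by (auto simp: endpoints_def)
        \<comment> \<open>Any other parametrisation of the arc \<open>C\<close> extends to one of all arcs, and the solution sets
            of \<open>b_E = 1\<close> and \<open>b_E = -1\<close> do not depend on it.\<close>
        have st': "arc_param E (s(C := s')) (t(C := t'))"
          using st C(2-4) by (simp add: arc_param_def)
        have "cis s' \<in> cis ` (s(C := s')) ` K" "cis t' \<in> cis ` (t(C := t')) ` K"
          using C(1) by (auto simp: image_iff intro!: bexI[of _ C])
        then show "z \<in> {z. b_fun E z = 1} \<union> {z. b_fun E z = -1}"
          unfolding recovery[OF st'] using C(5) by blast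
      qed
      show "{z. b_fun E z = 1} \<union> {z. b_fun E z = -1} \<subseteq> \<Union>(endpoints ` K)"
        unfolding recovery[OF st]
      proof
        fix z assume "z \<in> cis ` s ` K \<union> cis ` t ` K"
        then obtain C where C: "C \<in> K" "z = cis (s C) \<or> z = cis (t C)" by blast
        moreover have "s C \<le> t C \<and> t C < s C + 2 * pi \<and> C = cis ` {s C..t C}"
          using st C(1) by (simp add: arc_param_def K_def)
        ultimately have "z \<in> endpoints C" unfolding endpoints_def by blast
        then show "z \<in> \<Union>(endpoints ` K)" using C(1) by blast
      qed
    qed
    moreover have "{A \<in> arcs_of E. \<not> is_singleton A} = K" using False by (simp add: arcs_of_def K_def)
    moreover note ap = arc_polynomials[OF comps(1) st, folded K_def]
    note rec = recovery_from_quotient[OF circle_integrable_components[OF comps(1) st]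
        ap(9) ap(3) ap(4-8) K c m assms(6)]
    ultimately show ?thesis using rec(1-5) by simp
  qed
qed

end
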